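(* Let $B$ be a graph with $n$ vertices and $m$ edges, where $m \ge n$. Let $\sigma = s(L(B))$, suppose that $2$ is not an eigenvalue of the signless Laplacian $Q(B)$, and suppose that $v$ is a vertex of $B$ with $\varphi_B(v) > 0$. For $k \ge 1$ let $B_k$ be the graph consisting of $k$ disjoint copies of $B$ together with, for each $1 \le i \le k-1$, one additional edge joining the vertex $v$ of copy $i$ to the vertex $v$ of copy $i+1$. Then $$s(L(B_k)) = k\sigma - (k-1) \qquad \text{for all } k \ge 1.$$
   Context: All graphs are finite and simple. For a graph $H$ with adjacency matrix $A(H)$, the signature $s(H)$ is the number of positive eigenvalues of $A(H)$ minus the number of negative eigenvalues of $A(H)$, counted with multiplicity. The line graph $L(G)$ has the edges of $G$ as vertices, two being adjacent when they are distinct and share an endpoint. The signless Laplacian of $G$ is $Q(G) = A(G) + D(G)$, where $D(G)$ is the diagonal matrix of vertex degrees. For a graph $G$ such that $2$ is not an eigenvalue of $Q(G)$, and a vertex $x$ of $G$, $\varphi_G(x)$ denotes the $(x,x)$ entry of $(Q(G) - 2I)^{-1}$. *)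

theory Defs
  imports
    "Jordan_Normal_Form.Char_Poly"
    "Jordan_Normal_Form.Gauss_Jordan_Elimination"
begin

record 'a ugraph =
  verts :: "'a set"
  edges :: "'a set set"

definition simple_graph :: "'a ugraph \<Rightarrow> bool" where
  "simple_graph G \<longleftrightarrow> finite (verts G) \<and> (\<forall>e\<in>edges G. e \<subseteq> verts G \<and> card e = 2)"

definition vertex_degree :: "'a ugraph \<Rightarrow> 'a \<Rightarrow> nat" where
  "vertex_degree G x = card {e \<in> edges G. x \<in> e}"

definition line_graph :: "'a ugraph \<Rightarrow> 'a set ugraph" where
  "line_graph G = \<lparr> verts = edges G,
     edges = {{e, f} | e f. e \<in> edges G \<and> f \<in> edges G \<and> e \<noteq> f \<and> e \<inter> f \<noteq> {}} \<rparr>"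

text \<open>The vertex \<open>x\<close> of the \<open>i\<close>-th copy of \<open>B\<close> is the pair \<open>(i, x)\<close>.\<close>

definition chain_graph :: "'a ugraph \<Rightarrow> 'a \<Rightarrow> nat \<Rightarrow> (nat \<times> 'a) ugraph" where
  "chain_graph B v k = \<lparr> verts = {1..k} \<times> verts B,
     edges = {Pair i ` e | i e. i \<in> {1..k} \<and> e \<in> edges B} \<union>
             {{(i, v), (i + 1, v)} | i. 1 \<le> i \<and> i + 1 \<le> k} \<rparr>"

text \<open>Matrices of a graph are indexed by \<open>{0..<n}\<close> through an arbitrary but fixed
  enumeration of the vertex set. Another enumeration conjugates all the matrices below by the
  same permutation matrix, so eigenvalues, their multiplicities and \<open>phi\<close> do not depend on it.\<close>

definition vertex_list :: "'a ugraph \<Rightarrow> 'a list" where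
  "vertex_list G = (SOME xs. distinct xs \<and> set xs = verts G)"

definition vertex_index :: "'a ugraph \<Rightarrow> 'a \<Rightarrow> nat" where
  "vertex_index G x = (THE i. i < length (vertex_list G) \<and> vertex_list G ! i = x)"

definition adjacency_matrix :: "'a ugraph \<Rightarrow> real mat" where
  "adjacency_matrix G = mat (card (verts G)) (card (verts G))
     (\<lambda>(i, j). if {vertex_list G ! i, vertex_list G ! j} \<in> edges G then 1 else 0)"

definition degree_matrix :: "'a ugraph \<Rightarrow> real mat" where
  "degree_matrix G = mat (card (verts G)) (card (verts G))
     (\<lambda>(i, j). if i = j then real (vertex_degree G (vertex_list G ! i)) else 0)"

definition signless_laplacian :: "'a ugraph \<Rightarrow> real mat" where
  "signless_laplacian G = adjacency_matrix G + degree_matrix G"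

text \<open>For a real symmetric matrix all eigenvalues are real, and the multiplicity of an eigenvalue
  as a root of the characteristic polynomial is the dimension of its eigenspace.\<close>

definition matrix_signature :: "real mat \<Rightarrow> int" where
  "matrix_signature A =
     int (\<Sum>x | eigenvalue A x \<and> x > 0. order x (char_poly A)) -
     int (\<Sum>x | eigenvalue A x \<and> x < 0. order x (char_poly A))"

definition signature :: "'a ugraph \<Rightarrow> int" where
  "signature G = matrix_signature (adjacency_matrix G)"

text \<open>Meaningful only if 2 is not an eigenvalue of the signless Laplacian;
  otherwise \<open>mat_inverse\<close> returns \<open>None\<close>.\<close>

definition phi :: "'a ugraph \<Rightarrow> 'a \<Rightarrow> real" where
  "phi G x =
     the (mat_inverse (signless_laplacian G - 2 \<cdot>\<^sub>m 1\<^sub>m (card (verts G))))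
       $$ (vertex_index G x, vertex_index G x)"

lemma vertex_list:
  assumes "finite (verts G)"
  shows "distinct (vertex_list G)" "set (vertex_list G) = verts G"
    "length (vertex_list G) = card (verts G)"
proof -
  have "\<exists>xs. distinct xs \<and> set xs = verts G"
    using finite_distinct_list[OF assms] by blast
  from someI_ex[OF this] show "distinct (vertex_list G)" "set (vertex_list G) = verts G"
    unfolding vertex_list_def by auto
  then show "length (vertex_list G) = card (verts G)"
    by (metis distinct_card)
qed

lemma vertex_index:
  assumes "finite (verts G)" "x \<in> verts G"
  shows "vertex_index G x < card (verts G)" "vertex_list G ! vertex_index G x = x"
proof -
  have "\<exists>!i. i < length (vertex_list G) \<and> vertex_list G ! i = x"
    using vertex_list[OF assms(1)] assms(2) by (metis in_set_conv_nth nth_eq_iff_index_eq)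
  from theI'[OF this]
  show "vertex_index G x < card (verts G)" "vertex_list G ! vertex_index G x = x"
    unfolding vertex_index_def using vertex_list(3)[OF assms(1)] by auto
qed

lemma finite_edges:
  assumes "simple_graph G"
  shows "finite (edges G)"
proof -
  have "edges G \<subseteq> Pow (verts G)" "finite (Pow (verts G))"
    using assms by (auto simp: simple_graph_def)
  then show ?thesis by (rule finite_subset)
qed

lemma simple_graph_line_graph:
  assumes "simple_graph G"
  shows "simple_graph (line_graph G)"
  unfolding simple_graph_def
proof (intro conjI ballI)
  show "finite (verts (line_graph G))"
    using finite_edges[OF assms] by (simp add: line_graph_def)
next
  fix p assume "p \<in> edges (line_graph G)"
  then obtain e f where "p = {e, f}" "e \<in> edges G" "f \<in> edges G" "e \<noteq> f"
    by (auto simp: line_graph_def)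
  then show "p \<subseteq> verts (line_graph G)" "card p = 2"
    by (simp_all add: line_graph_def)
qed

lemma simple_graph_chain_graph:
  assumes "simple_graph B" "v \<in> verts B"
  shows "simple_graph (chain_graph B v k)"
  unfolding simple_graph_def
proof (intro conjI ballI)
  show "finite (verts (chain_graph B v k))"
    using assms by (simp add: simple_graph_def chain_graph_def)
next
  fix p assume "p \<in> edges (chain_graph B v k)"
  then consider (copy) i e where "p = Pair i ` e" "i \<in> {1..k}" "e \<in> edges B"
    | (link) i where "p = {(i, v), (i + 1, v)}" "1 \<le> i" "i + 1 \<le> k"
    unfolding chain_graph_def by auto
  then have "p \<subseteq> verts (chain_graph B v k) \<and> card p = 2"
  proof cases
    case copy
    have "card (Pair i ` e) = card e"
      by (rule card_image) (simp add: inj_on_def)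
    moreover have "e \<subseteq> verts B" "card e = 2"
      using assms(1) copy(3) by (auto simp: simple_graph_def)
    ultimately show ?thesis
      using copy by (auto simp: chain_graph_def)
  next
    case link
    then show ?thesis
      using assms(2) by (simp add: chain_graph_def)
  qed
  then show "p \<subseteq> verts (chain_graph B v k)" "card p = 2"
    by auto
qed

end

theory Submission
  imports Defs "Jordan_Normal_Form.Spectral_Radius"
begin

text \<open>Let \<open>N\<close> be the incidence matrix of \<open>B\<close>, so that \<open>N N\<^sup>T = Q(B)\<close> and
  \<open>N\<^sup>T N - 2I\<close> is the adjacency matrix of \<open>L(B)\<close>, with quadratic form
  \<open>q(x) = |N x|\<^sup>2 - 2|x|\<^sup>2\<close>. In \<open>L(B\<^sub>k)\<close>, a vector restricts to a vector \<open>x\<^sub>i\<close> on the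
  \<open>i\<close>-th copy of \<open>B\<close> and to a number \<open>y\<^sub>i\<close> on the \<open>i\<close>-th additional edge; with
  \<open>c\<^sub>i = y\<^sub>i + y\<^bsub>i-1\<^esub>\<close> and \<open>y\<^sub>0 = y\<^sub>k = 0\<close> its form is
  \<open>\<Sum>\<^sub>i (|N x\<^sub>i + c\<^sub>i e\<^sub>v|\<^sup>2 - 2|x\<^sub>i|\<^sup>2) - 2 \<Sum>\<^sub>i y\<^sub>i\<^sup>2\<close>.
  For \<open>h = (Q(B) - 2I)\<^bsup>-1\<^esup> e\<^sub>v\<close>, completing the square turns the \<open>i\<close>-th block into
  \<open>q(x\<^sub>i + c\<^sub>i N\<^sup>T h) - 2 \<phi>(v) c\<^sub>i\<^sup>2\<close>. As \<open>\<phi>(v) > 0\<close>, the coordinates \<open>y\<^sub>i\<close> contribute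
  \<open>k - 1\<close> negative squares and the rest is \<open>k\<close> copies of \<open>q\<close>, which is nondegenerate
  because \<open>2\<close> is not an eigenvalue of \<open>Q(B)\<close>. Sylvester's law of inertia concludes.\<close>

section \<open>Diagonalization of real symmetric matrices\<close>

text \<open>A complex eigenpair \<open>z\<close>, \<open>w = a + i b\<close> exists. Comparing
  \<open>(A b) . a\<close> with \<open>b . (A a)\<close> gives
  \<open>Im z * (|a|^2 + |b|^2) = 0\<close>, so \<open>z\<close> is real and a nonzero one among
  \<open>a\<close>, \<open>b\<close> is a real eigenvector.\<close>

lemma real_symmetric_eigenvector:
  fixes A :: "real mat"
  assumes A: "A \<in> carrier_mat n n" and n: "n > 0" and sym: "transpose_mat A = A"
  obtains u l where "u \<in> carrier_vec n" "u \<bullet> u = 1" "A *\<^sub>v u = l \<cdot>\<^sub>v u"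
proof -
  define C where "C = map_mat complex_of_real A"
  have C: "C \<in> carrier_mat n n" using A by (simp add: C_def)
  obtain z where "z \<in> spectrum C" using spectrum_non_empty[OF C n] by blast
  then obtain w where w: "w \<in> carrier_vec n" "w \<noteq> 0\<^sub>v n" "C *\<^sub>v w = z \<cdot>\<^sub>v w"
    using C unfolding spectrum_def eigenvalue_def eigenvector_def by auto
  define a where "a = map_vec Re w"
  define b where "b = map_vec Im w"
  have ab: "a \<in> carrier_vec n" "b \<in> carrier_vec n" using w by (simp_all add: a_def b_def)
  have Cw: "(\<Sum>j<n. complex_of_real (A $$ (i,j)) * w $ j) = z * w $ i" if "i < n" for i
  proof -
    have "(C *\<^sub>v w) $ i = (z \<cdot>\<^sub>v w) $ i" using w by simp
    then show ?thesis using that w A C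
      by (simp add: scalar_prod_def C_def atLeast0LessThan)
  qed
  have Aa: "A *\<^sub>v a = Re z \<cdot>\<^sub>v a - Im z \<cdot>\<^sub>v b"
  proof (rule eq_vecI)
    fix i assume "i < dim_vec (Re z \<cdot>\<^sub>v a - Im z \<cdot>\<^sub>v b)"
    then have i: "i < n" using ab by simp
    have "(A *\<^sub>v a) $ i = Re (\<Sum>j<n. complex_of_real (A $$ (i,j)) * w $ j)"
      using i A w by (simp add: scalar_prod_def a_def atLeast0LessThan)
    then show "(A *\<^sub>v a) $ i = (Re z \<cdot>\<^sub>v a - Im z \<cdot>\<^sub>v b) $ i"
      using Cw[OF i] i w by (simp add: a_def b_def)
  qed (use A ab in auto)
  have Ab: "A *\<^sub>v b = Im z \<cdot>\<^sub>v a + Re z \<cdot>\<^sub>v b"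
  proof (rule eq_vecI)
    fix i assume "i < dim_vec (Im z \<cdot>\<^sub>v a + Re z \<cdot>\<^sub>v b)"
    then have i: "i < n" using ab by simp
    have "(A *\<^sub>v b) $ i = Im (\<Sum>j<n. complex_of_real (A $$ (i,j)) * w $ j)"
      using i A w by (simp add: scalar_prod_def b_def atLeast0LessThan)
    then show "(A *\<^sub>v b) $ i = (Im z \<cdot>\<^sub>v a + Re z \<cdot>\<^sub>v b) $ i"
      using Cw[OF i] i w by (simp add: a_def b_def)
  qed (use A ab in auto)
  have pos: "a \<bullet> a + b \<bullet> b > 0"
  proof -
    obtain i where i: "i < n" "w $ i \<noteq> 0" using w by (metis eq_vecI carrier_vecD index_zero_vec)
    have "0 < (Re (w $ i))\<^sup>2 + (Im (w $ i))\<^sup>2"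
      using i(2) by (metis complex_neq_0)
    also have "\<dots> \<le> (\<Sum>i<n. (Re (w $ i))\<^sup>2 + (Im (w $ i))\<^sup>2)"
      using i by (intro member_le_sum) auto
    also have "\<dots> = a \<bullet> a + b \<bullet> b"
      using w by (simp add: a_def b_def scalar_prod_def atLeast0LessThan sum.distrib power2_eq_square)
    finally show ?thesis .
  qed
  have "(A *\<^sub>v b) \<bullet> a = b \<bullet> (A *\<^sub>v a)"
    using transpose_vec_mult_scalar[OF A ab(1) ab(2)] sym by simp
  then have "Im z * (a \<bullet> a) + Re z * (b \<bullet> a) = Re z * (b \<bullet> a) - Im z * (b \<bullet> b)"
    unfolding Aa Ab using ab
    by (simp add: add_scalar_prod_distrib[of _ n] scalar_prod_minus_distrib[of _ n])
  then have "Im z * (a \<bullet> a + b \<bullet> b) = 0" by (simp add: algebra_simps)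
  with pos have Im: "Im z = 0" by simp
  obtain x where x: "x \<in> carrier_vec n" "x \<bullet> x > 0" "A *\<^sub>v x = Re z \<cdot>\<^sub>v x"
  proof (cases "a \<bullet> a > 0")
    case True
    have "Re z \<cdot>\<^sub>v a - 0 \<cdot>\<^sub>v b = Re z \<cdot>\<^sub>v a" using ab by auto
    then show ?thesis using that[of a] True Aa ab Im by auto
  next
    case False
    have "0 \<cdot>\<^sub>v a + Re z \<cdot>\<^sub>v b = Re z \<cdot>\<^sub>v b" using ab by auto
    then show ?thesis using that[of b] False Ab ab Im pos by auto
  qed
  define c where "c = 1 / sqrt (x \<bullet> x)"
  show ?thesis
  proof (rule that[of "c \<cdot>\<^sub>v x" "Re z"])
    show "(c \<cdot>\<^sub>v x) \<bullet> (c \<cdot>\<^sub>v x) = 1"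
      using x by (simp add: c_def)
    show "A *\<^sub>v (c \<cdot>\<^sub>v x) = Re z \<cdot>\<^sub>v (c \<cdot>\<^sub>v x)"
      using x A by (simp add: mult_mat_vec smult_smult_assoc mult.commute)
  qed (use x in auto)
qed

text \<open>For \<open>u\<close> different from the first unit vector \<open>e_0\<close>,
  \<open>H\<close> is the reflection along \<open>w = u - e_0\<close>, which swaps the two unit
  vectors. It stands in for extending \<open>u\<close> to an orthonormal basis.\<close>

lemma householder:
  fixes u :: "real vec"
  assumes u: "u \<in> carrier_vec n" "u \<bullet> u = 1" and n: "n > 0"
  obtains H where "H \<in> carrier_mat n n" "transpose_mat H = H" "H * H = 1\<^sub>m n" "col H 0 = u"
proof -
  define w where "w i = u $ i - (if i = 0 then 1 else 0)" for i
  define s where "s = (\<Sum>i<n. w i * w i)"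
  \<comment> \<open>If \<open>u\<close> is already the first unit vector, then \<open>s = 0\<close>, so \<open>t = 2 / 0 = 0\<close> and \<open>H = 1\<close>.\<close>
  define t where "t = 2 / s"
  define H where "H = mat n n (\<lambda>(i,j). (if i = j then 1 else 0) - t * w i * w j)"
  have uu: "(\<Sum>i<n. u $ i * u $ i) = 1" using u by (simp add: scalar_prod_def atLeast0LessThan)
  have s: "s = 2 - 2 * u $ 0"
  proof -
    have "s = (\<Sum>i<n. u $ i * u $ i + (if i = 0 then 1 - 2 * u $ i else 0))"
      unfolding s_def w_def by (rule sum.cong) (auto simp: algebra_simps)
    also have "\<dots> = 1 + (1 - 2 * u $ 0)"
      using uu n by (simp add: sum.distrib sum.delta)
    finally show ?thesis by simp
  qed
  \<comment> \<open>This holds for \<open>s = 0\<close> as well, because \<open>t = 0\<close> then;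
    so \<open>H * H = 1\<close> is proved without a case split.\<close>
  have tts: "t * t * s = 2 * t" by (simp add: t_def)
  have w0: "w i = 0" if "s = 0" "i < n" for i
  proof -
    have "\<forall>i\<in>{..<n}. w i * w i = 0"
      using \<open>s = 0\<close> unfolding s_def by (subst (asm) sum_nonneg_eq_0_iff) auto
    then show ?thesis using \<open>i < n\<close> by simp
  qed
  have H: "H \<in> carrier_mat n n" by (simp add: H_def)
  show ?thesis
  proof (rule that[OF H])
    show "transpose_mat H = H"
      by (rule eq_matI) (auto simp: H_def)
    show "H * H = 1\<^sub>m n"
    proof (rule eq_matI)
      fix i j assume "i < dim_row (1\<^sub>m n :: real mat)" "j < dim_col (1\<^sub>m n :: real mat)"
      then have ij: "i < n" "j < n" by auto
      have "(H * H) $$ (i,j) = (\<Sum>k<n. ((if i = k then 1 else 0) - t * w i * w k) * ((if k = j then 1 else 0) - t * w k * w j))"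
        using ij by (simp add: H_def scalar_prod_def atLeast0LessThan)
      also have "\<dots> = (\<Sum>k<n. (if k = i then (if k = j then 1 else 0) - t * w k * w j else 0)
          - (if k = j then t * w i * w k else 0) + t * t * w i * w j * (w k * w k))"
        by (rule sum.cong) (auto simp: algebra_simps)
      also have "\<dots> = (if i = j then 1 else 0) - t * w i * w j - t * w i * w j + t * t * w i * w j * s"
        using ij by (simp add: sum.distrib sum_subtractf sum.delta sum_distrib_left[symmetric] s_def[symmetric])
      also have "t * t * w i * w j * s = (t * t * s) * w i * w j" by simp
      finally show "(H * H) $$ (i,j) = 1\<^sub>m n $$ (i,j)"
        using ij by (simp add: tts)
    qed (auto simp: H_def)
    show "col H 0 = u"
    proof (rule eq_vecI)
      fix i assume "i < dim_vec u"
      then have i: "i < n" using u by simp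
      \<comment> \<open>Entry \<open>(i, 0)\<close> of \<open>H\<close> thus becomes the Kronecker
        delta plus \<open>w i\<close>, which is \<open>u $ i\<close>.\<close>
      have "t * w 0 * w i = - w i"
      proof (cases "s = 0")
        case True
        then show ?thesis using w0[OF True i] by simp
      next
        case False
        have "w 0 = - s / 2" by (simp add: w_def s)
        then show ?thesis using False by (simp add: t_def)
      qed
      then show "col H 0 $ i = u $ i"
        using i n by (auto simp: H_def w_def mult_ac)
    qed (use u in \<open>auto simp: H_def\<close>)
  qed
qed

text \<open>Deflation: conjugating by a reflection that sends \<open>e_0\<close> to a unit
  eigenvector splits off a block of size 1, and the induction hypothesis diagonalizes the remaining
  symmetric block.\<close>

lemma real_symmetric_diagonalization:
  fixes A :: "real mat"
  assumes "A \<in> carrier_mat n n" "transpose_mat A = A"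
  shows "\<exists>P d. P \<in> carrier_mat n n \<and> transpose_mat P * P = 1\<^sub>m n \<and>
    A = P * mat n n (\<lambda>(i, j). if i = j then d i else 0) * transpose_mat P"
  using assms
proof (induction n arbitrary: A)
  case 0
  then show ?case by (intro exI[of _ "1\<^sub>m 0"] exI) (auto intro!: eq_matI)
next
  case (Suc n)
  note A = Suc.prems(1) and sym = Suc.prems(2)
  obtain u l where u: "u \<in> carrier_vec (Suc n)" "u \<bullet> u = 1" "A *\<^sub>v u = l \<cdot>\<^sub>v u"
    using real_symmetric_eigenvector[OF A _ sym] by blast
  obtain H where H: "H \<in> carrier_mat (Suc n) (Suc n)" "transpose_mat H = H" "H * H = 1\<^sub>m (Suc n)" "col H 0 = u"
    using householder[OF u(1,2)] by blast
  define C where "C = H * A * H"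
  have C: "C \<in> carrier_mat (Suc n) (Suc n)" using A H by (simp add: C_def)
  have symC: "transpose_mat C = C"
  proof -
    have "transpose_mat C = transpose_mat H * (transpose_mat A * transpose_mat H)"
      unfolding C_def using A H by (simp add: transpose_mult[of _ "Suc n" "Suc n" _ "Suc n"])
    then show ?thesis using A H sym by (simp add: C_def assoc_mult_mat[of _ "Suc n" "Suc n" _ "Suc n" _ "Suc n"])
  qed
  have Hu: "H *\<^sub>v u = unit_vec (Suc n) 0"
  proof -
    have "H *\<^sub>v u = col (H * H) 0" using H by (metis col_mult2 zero_less_Suc)
    then show ?thesis using H by simp
  qed
  have colC: "col C 0 = l \<cdot>\<^sub>v unit_vec (Suc n) 0"
  proof -
    have "col C 0 = (H * A) *\<^sub>v col H 0"
      unfolding C_def using A H by (intro col_mult2) auto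
    also have "\<dots> = H *\<^sub>v (A *\<^sub>v u)" using A H u by (simp add: assoc_mult_mat_vec[of _ "Suc n" "Suc n"])
    also have "\<dots> = l \<cdot>\<^sub>v (H *\<^sub>v u)" using u H by (simp add: mult_mat_vec)
    finally show ?thesis by (simp add: Hu)
  qed
  have C0: "C $$ (i, 0) = (if i = 0 then l else 0)" if "i < Suc n" for i
  proof -
    have "C $$ (i, 0) = col C 0 $ i" using that C by simp
    then show ?thesis using that unfolding colC by simp
  qed
  have Csym: "C $$ (i, j) = C $$ (j, i)" if "i < Suc n" "j < Suc n" for i j
    using symC C that by (metis index_transpose_mat(1) carrier_matD)
  define A' where "A' = mat n n (\<lambda>(i,j). C $$ (Suc i, Suc j))"
  have A': "A' \<in> carrier_mat n n" "transpose_mat A' = A'"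
    by (auto simp: A'_def Csym intro!: eq_matI)
  define L where "L = mat 1 1 (\<lambda>_. l)"
  have L: "L \<in> carrier_mat 1 1" by (simp add: L_def)
  \<comment> \<open>Column 0 of \<open>C\<close> is \<open>l\<close> times a unit vector; symmetry
    gives the same for row 0.\<close>
  have Cblock: "C = four_block_mat L (0\<^sub>m 1 n) (0\<^sub>m n 1) A'"
    by (rule eq_matI) (use C C0 Csym[of 0] in \<open>auto simp: L_def A'_def\<close>)
  obtain P d where P: "P \<in> carrier_mat n n" "transpose_mat P * P = 1\<^sub>m n"
    "A' = P * mat n n (\<lambda>(i, j). if i = j then d i else 0) * transpose_mat P"
    using Suc.IH[OF A'] by blast
  let ?D = "mat n n (\<lambda>(i, j). if i = j then d i else 0)"
  define R where "R = four_block_mat (1\<^sub>m 1) (0\<^sub>m 1 n) (0\<^sub>m n 1) P"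
  define d' where "d' i = (if i = 0 then l else d (i - 1))" for i
  let ?D' = "mat (Suc n) (Suc n) (\<lambda>(i, j). if i = j then d' i else 0)"
  have D: "?D \<in> carrier_mat n n" by simp
  have PT: "transpose_mat P \<in> carrier_mat n n" using P by simp
  have R: "R \<in> carrier_mat (Suc n) (Suc n)" using four_block_carrier_mat[of "1\<^sub>m 1 :: real mat" 1 1 P n n] P(1) by (simp add: R_def)
  have RT: "transpose_mat R = four_block_mat (1\<^sub>m 1) (0\<^sub>m 1 n) (0\<^sub>m n 1) (transpose_mat P)"
    unfolding R_def by (subst transpose_four_block_mat[of _ 1 1 _ n _ n]) (use P in auto)
  have RTR: "transpose_mat R * R = 1\<^sub>m (Suc n)"
    unfolding RT unfolding R_def
    by (subst mult_four_block_mat[of _ 1 1 _ n _ n _ _ 1 _ n]) (use P PT in auto)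
  have D'block: "?D' = four_block_mat L (0\<^sub>m 1 n) (0\<^sub>m n 1) ?D"
    by (rule eq_matI) (auto simp: L_def d'_def)
  have "R * ?D' = four_block_mat L (0\<^sub>m 1 n) (0\<^sub>m n 1) (P * ?D)"
    unfolding D'block R_def
    by (subst mult_four_block_mat[of _ 1 1 _ n _ n _ _ 1 _ n]) (use P L in auto)
  also have "\<dots> * transpose_mat R = four_block_mat L (0\<^sub>m 1 n) (0\<^sub>m n 1) (P * ?D * transpose_mat P)"
    unfolding RT
    by (subst mult_four_block_mat[of _ 1 1 _ n _ n _ _ 1 _ n]) (use P PT L in auto)
  finally have RDR: "C = R * ?D' * transpose_mat R"
    unfolding Cblock P(3) by simp
  have D': "?D' \<in> carrier_mat (Suc n) (Suc n)" by simp
  \<comment> \<open>As \<open>H\<close> is its own inverse, the diagonalization of \<open>C\<close>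
    carries back to \<open>A\<close>, with orthogonal matrix \<open>H * R\<close>.\<close>
  have "H * C * H = A"
  proof -
    have "H * C * H = (H * H) * A * (H * H)"
      unfolding C_def using A H(1) by (simp add: assoc_mult_mat[of _ "Suc n" "Suc n" _ "Suc n" _ "Suc n"])
    then show ?thesis using A H(3) by simp
  qed
  then have "A = (H * R) * ?D' * transpose_mat (H * R)"
    unfolding transpose_mult[OF H(1) R] H(2) RDR using H(1) R D'
    by (simp add: assoc_mult_mat[of _ "Suc n" "Suc n" _ "Suc n" _ "Suc n"])
  moreover have "transpose_mat (H * R) * (H * R) = transpose_mat R * (H * H) * R"
    unfolding transpose_mult[OF H(1) R] H(2) using H(1) R
    by (simp add: assoc_mult_mat[of _ "Suc n" "Suc n" _ "Suc n" _ "Suc n"])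
  then have "transpose_mat (H * R) * (H * R) = 1\<^sub>m (Suc n)"
    using R RTR by (simp add: H(3))
  moreover have "H * R \<in> carrier_mat (Suc n) (Suc n)" using H(1) R by simp
  ultimately show ?case by blast
qed

section \<open>Signature and inertia\<close>

text \<open>Vectors indexed by \<open>V\<close> are represented by total functions. Explicit
  coefficients ensure linearity and also that only the values on \<open>V\<close> matter.\<close>

definition linear_functional :: "'v set \<Rightarrow> (('v \<Rightarrow> real) \<Rightarrow> real) \<Rightarrow> bool" where
  "linear_functional V \<psi> \<longleftrightarrow> (\<exists>a. \<forall>f. \<psi> f = (\<Sum>u\<in>V. a u * f u))"

text \<open>The quadratic form \<open>x^T A x\<close> of the adjacency matrix, free of any
  enumeration of the vertices; each edge is counted in both orders.\<close>

definition adjacency_form :: "'v ugraph \<Rightarrow> ('v \<Rightarrow> real) \<Rightarrow> real" where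
  "adjacency_form G f =
     (\<Sum>u\<in>verts G. \<Sum>w\<in>verts G. if {u, w} \<in> edges G then f u * f w else 0)"

lemma order_linear_factor: "order x [:- a, 1:] = (if a = (x::real) then 1 else 0)"
  using order_power_n_n[of x 1] by (auto intro: order_0I)

lemma order_prod_linear_factors:
  fixes d :: "'i \<Rightarrow> real"
  assumes "finite S"
  shows "order x (\<Prod>j\<in>S. [:- d j, 1:]) = card {j \<in> S. d j = x}"
  using assms
proof (induction rule: finite_induct)
  case (insert k S)
  have nz: "[:- d k, 1:] * (\<Prod>j\<in>S. [:- d j, 1:]) \<noteq> 0"
    using insert(1) by (simp del: mult_pCons_left)
  have set: "{j \<in> insert k S. d j = x} =
      (if d k = x then insert k {j \<in> S. d j = x} else {j \<in> S. d j = x})"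
    by auto
  have "order x (\<Prod>j\<in>insert k S. [:- d j, 1:])
      = order x [:- d k, 1:] + order x (\<Prod>j\<in>S. [:- d j, 1:])"
    unfolding prod.insert[OF insert(1,2)] by (rule order_mult[OF nz])
  also have "\<dots> = card {j \<in> insert k S. d j = x}"
    unfolding set insert.IH order_linear_factor using insert(1,2) by simp
  finally show ?case .
qed simp

text \<open>Orthogonality of \<open>P\<close> makes \<open>A\<close> similar to the diagonal matrix,
  so the characteristic polynomial is the product of the factors \<open>X - d j\<close>, and the
  order of a root \<open>x\<close> is the number of indices with \<open>d j = x\<close>.\<close>

lemma matrix_signature_diagonalization:
  fixes A P :: "real mat"
  assumes P: "P \<in> carrier_mat n n" "transpose_mat P * P = 1\<^sub>m n"
    and A: "A = P * mat n n (\<lambda>(i, j). if i = j then d i else 0) * transpose_mat P"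
  shows "matrix_signature A = int (card {j. j < n \<and> d j > 0}) - int (card {j. j < n \<and> d j < 0})"
    and "j < n \<Longrightarrow> eigenvalue A (d j)"
proof -
  let ?D = "mat n n (\<lambda>(i, j). if i = j then d i else 0)"
  have cA: "A \<in> carrier_mat n n"
    unfolding A by (intro mult_carrier_mat[of _ n n]) (use P in auto)
  have "P * transpose_mat P = 1\<^sub>m n"
    using mat_mult_left_right_inverse[OF _ P(1) P(2)] P(1) by simp
  then have "similar_mat A ?D"
    using P cA by (intro similar_matI[OF _ _ _ A, of n]) auto
  then have "char_poly A = char_poly ?D" by (rule char_poly_similar)
  also have "\<dots> = (\<Prod>a\<leftarrow>diag_mat ?D. [:- a, 1:])"
    by (rule char_poly_upper_triangular[of _ n]) (auto simp: upper_triangular_def)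
  also have "\<dots> = (\<Prod>j<n. [:- d j, 1:])"
  proof -
    have "diag_mat ?D = map d [0..<n]" by (auto simp: diag_mat_def)
    then show ?thesis
      by (simp add: prod.distinct_set_conv_list[symmetric] atLeast0LessThan o_def)
  qed
  finally have cp: "char_poly A = (\<Prod>j<n. [:- d j, 1:])" .
  have ord: "order x (char_poly A) = card {j. j < n \<and> d j = x}" for x
    unfolding cp by (subst order_prod_linear_factors) (auto intro!: arg_cong[of _ _ card])
  have ev: "eigenvalue A x \<longleftrightarrow> x \<in> d ` {..<n}" for x
    unfolding eigenvalue_root_char_poly[OF cA] cp by (auto simp: poly_prod)
  show "j < n \<Longrightarrow> eigenvalue A (d j)" using ev by simp
  \<comment> \<open>An arbitrary predicate \<open>R\<close> covers both signs at once. The index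
    sets belonging to different eigenvalues are disjoint, so their sizes add up.\<close>
  have count: "(\<Sum>x | eigenvalue A x \<and> R x. order x (char_poly A)) = card {j. j < n \<and> R (d j)}" for R
  proof -
    have "(\<Sum>x | eigenvalue A x \<and> R x. order x (char_poly A))
        = (\<Sum>x \<in> {x \<in> d ` {..<n}. R x}. card {j. j < n \<and> d j = x})"
      unfolding ord ev by simp
    also have "\<dots> = card (\<Union>x \<in> {x \<in> d ` {..<n}. R x}. {j. j < n \<and> d j = x})"
      by (subst card_UN_disjoint) auto
    also have "(\<Union>x \<in> {x \<in> d ` {..<n}. R x}. {j. j < n \<and> d j = x}) = {j. j < n \<and> R (d j)}"
      by auto
    finally show ?thesis .
  qed
  show "matrix_signature A = int (card {j. j < n \<and> d j > 0}) - int (card {j. j < n \<and> d j < 0})"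
    unfolding matrix_signature_def by (simp only: count)
qed

section \<open>From matrices to functions on the vertex set\<close>

lemma bij_betw_vertex_list:
  assumes "finite (verts G)"
  shows "bij_betw ((!) (vertex_list G)) {..<card (verts G)} (verts G)"
  using vertex_list[OF assms] by (intro bij_betw_nth) auto

lemma sum_verts:
  assumes "finite (verts G)"
  shows "(\<Sum>u\<in>verts G. F u) = (\<Sum>i<card (verts G). F (vertex_list G ! i))"
  using sum.reindex_bij_betw[OF bij_betw_vertex_list[OF assms], of F] by simp

lemma vertex_index_nth:
  assumes "finite (verts G)" "i < card (verts G)"
  shows "vertex_index G (vertex_list G ! i) = i"
  using vertex_list[OF assms(1)] vertex_index[OF assms(1), of "vertex_list G ! i"] assms
  by (metis nth_eq_iff_index_eq nth_mem)

text \<open>The spectral theorem as a bundle of facts about functions on vertices. The third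
  conjunct makes the \<open>\<xi> j\<close>, as many as there are vertices, a system of linear
  coordinates.\<close>

definition diagonalizes_adjacency ::
    "'v ugraph \<Rightarrow> (nat \<Rightarrow> real) \<Rightarrow> (nat \<Rightarrow> ('v \<Rightarrow> real) \<Rightarrow> real) \<Rightarrow> bool" where
  "diagonalizes_adjacency G d \<xi> \<longleftrightarrow>
    (\<forall>j<card (verts G). linear_functional (verts G) (\<xi> j)) \<and>
    (\<forall>f. adjacency_form G f = (\<Sum>j<card (verts G). d j * (\<xi> j f)\<^sup>2)) \<and>
    (\<forall>f. (\<forall>j<card (verts G). \<xi> j f = 0) \<longrightarrow> (\<forall>u\<in>verts G. f u = 0)) \<and>
    (\<forall>j<card (verts G). eigenvalue (adjacency_matrix G) (d j)) \<and>
    signature G = int (card {j. j < card (verts G) \<and> d j > 0})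
      - int (card {j. j < card (verts G) \<and> d j < 0})"

text \<open>With \<open>A = P D P^T\<close>, the functional \<open>\<xi> j\<close> is the
  \<open>j\<close>-th coordinate of \<open>P^T x\<close>; the form becomes the one of
  \<open>D\<close>.\<close>

lemma adjacency_form_diagonalization:
  assumes fin: "finite (verts G)"
  obtains d \<xi> where "diagonalizes_adjacency G d \<xi>"
proof -
  define n where "n = card (verts G)"
  define A where "A = adjacency_matrix G"
  define X where "X = (!) (vertex_list G)"
  have A: "A \<in> carrier_mat n n" by (simp add: A_def adjacency_matrix_def n_def)
  have Aij: "A $$ (i, j) = (if {X i, X j} \<in> edges G then 1 else 0)" if "i < n" "j < n" for i j
    using that by (simp add: A_def adjacency_matrix_def n_def X_def)
  have "transpose_mat A = A"
    by (rule eq_matI) (use A in \<open>auto simp: Aij insert_commute\<close>)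
  then obtain P d where P: "P \<in> carrier_mat n n" "transpose_mat P * P = 1\<^sub>m n"
    "A = P * mat n n (\<lambda>(i, j). if i = j then d i else 0) * transpose_mat P"
    using real_symmetric_diagonalization[OF A] by blast
  let ?D = "mat n n (\<lambda>(i, j). if i = j then d i else 0)"
  \<comment> \<open>For square matrices a left inverse is a right inverse; this recovers a vector
    from its coordinates \<open>\<xi> j\<close>.\<close>
  have PP: "P * transpose_mat P = 1\<^sub>m n"
    using mat_mult_left_right_inverse[OF _ P(1) P(2)] P(1) by simp
  define x where "x f = vec n (\<lambda>i. f (X i))" for f :: "'a \<Rightarrow> real"
  have x: "x f \<in> carrier_vec n" for f by (simp add: x_def)
  define \<xi> where "\<xi> j f = (transpose_mat P *\<^sub>v x f) $ j" for j f
  have \<xi>: "\<xi> j f = (\<Sum>i<n. P $$ (i, j) * f (X i))" if "j < n" for j f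
    using that P(1) by (simp add: \<xi>_def x_def scalar_prod_def atLeast0LessThan)
  show ?thesis
  proof (rule that[of d \<xi>], unfold diagonalizes_adjacency_def n_def[symmetric], intro conjI allI impI ballI)
    fix j assume j: "j < n"
    show "linear_functional (verts G) (\<xi> j)"
      unfolding linear_functional_def
    proof (intro exI[of _ "\<lambda>u. P $$ (vertex_index G u, j)"] allI)
      fix f show "\<xi> j f = (\<Sum>u\<in>verts G. P $$ (vertex_index G u, j) * f u)"
        unfolding sum_verts[OF fin] \<xi>[OF j] using vertex_index_nth[OF fin] by (simp add: n_def X_def)
    qed
  next
    fix j assume j: "j < n"
    show "eigenvalue (adjacency_matrix G) (d j)"
      using matrix_signature_diagonalization(2)[OF P j] by (simp add: A_def)
  next
    fix f
    have "adjacency_form G f = (\<Sum>i<n. \<Sum>j<n. A $$ (i, j) * f (X i) * f (X j))"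
      unfolding adjacency_form_def sum_verts[OF fin] n_def[symmetric]
      by (intro sum.cong) (auto simp: Aij X_def)
    also have "\<dots> = x f \<bullet> (A *\<^sub>v x f)"
      using A by (simp add: x_def scalar_prod_def atLeast0LessThan sum_distrib_left mult_ac)
    also have "A *\<^sub>v x f = P *\<^sub>v (?D *\<^sub>v (transpose_mat P *\<^sub>v x f))"
      unfolding P(3) using P(1) x[of f]
      by (simp add: assoc_mult_mat_vec[of "P * ?D" n n "transpose_mat P" n] assoc_mult_mat_vec[of P n n ?D n])
    also have "x f \<bullet> \<dots> = (transpose_mat P *\<^sub>v x f) \<bullet> (?D *\<^sub>v (transpose_mat P *\<^sub>v x f))"
      using transpose_vec_mult_scalar[OF P(1) _ x[of f], of "?D *\<^sub>v (transpose_mat P *\<^sub>v x f)"]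
        mult_mat_vec_carrier[of ?D n n "transpose_mat P *\<^sub>v x f"] P(1) x[of f]
      by simp
    also have "\<dots> = (\<Sum>j<n. d j * (\<xi> j f)\<^sup>2)"
    proof -
      have "(?D *\<^sub>v y) $ j = d j * y $ j" if "j < n" "y \<in> carrier_vec n" for j y
      proof -
        have "(?D *\<^sub>v y) $ j = (\<Sum>i<n. (if j = i then d j else 0) * y $ i)"
          using that by (simp add: scalar_prod_def atLeast0LessThan)
        also have "\<dots> = (\<Sum>i<n. if j = i then d j * y $ i else 0)"
          by (intro sum.cong) auto
        finally show ?thesis using that by simp
      qed
      from this[of _ "transpose_mat P *\<^sub>v x f"]
      have "(?D *\<^sub>v (transpose_mat P *\<^sub>v x f)) $ j = d j * \<xi> j f" if "j < n" for j
        using that P(1) x[of f] by (simp add: \<xi>_def del: index_mult_mat_vec)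
      then show ?thesis
        unfolding scalar_prod_def[of "transpose_mat P *\<^sub>v x f"]
        using P(1) by (auto simp: \<xi>_def atLeast0LessThan power2_eq_square mult_ac intro!: sum.cong)
    qed
    finally show "adjacency_form G f = (\<Sum>j<n. d j * (\<xi> j f)\<^sup>2)" .
  next
    fix f u assume 0: "\<forall>j<n. \<xi> j f = 0" and u: "u \<in> verts G"
    have "transpose_mat P *\<^sub>v x f = 0\<^sub>v n"
      by (rule eq_vecI) (use P(1) 0 in \<open>auto simp: \<xi>_def\<close>)
    moreover have "x f = P *\<^sub>v (transpose_mat P *\<^sub>v x f)"
      using P(1) x[of f] PP assoc_mult_mat_vec[of P n n "transpose_mat P" n "x f"] by simp
    ultimately have "x f = 0\<^sub>v n" using P(1) by auto
    moreover have "x f $ vertex_index G u = f u"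
      using vertex_index[OF fin u] by (simp add: x_def X_def n_def)
    ultimately show "f u = 0"
      using vertex_index[OF fin u] by (simp add: n_def)
  next
    show "signature G = int (card {j. j < n \<and> d j > 0}) - int (card {j. j < n \<and> d j < 0})"
      unfolding signature_def using matrix_signature_diagonalization(1)[OF P] by (simp add: A_def)
  qed
qed

text \<open>A homogeneous linear system with fewer equations than unknowns has a nonzero solution.
  The coefficient matrix is padded with zero rows to a square one so that determinants
  apply.\<close>

lemma linear_functionals_common_kernel:
  assumes V: "finite V" and F: "finite F" "card F < card V"
    and lin: "\<And>\<psi>. \<psi> \<in> F \<Longrightarrow> linear_functional V \<psi>"
  obtains f where "\<exists>u\<in>V. f u \<noteq> 0" "\<And>\<psi>. \<psi> \<in> F \<Longrightarrow> \<psi> f = 0"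
proof -
  define n where "n = card V"
  obtain a where a: "\<And>\<psi> f. \<psi> \<in> F \<Longrightarrow> \<psi> f = (\<Sum>u\<in>V. a \<psi> u * f u)"
    using lin unfolding linear_functional_def by metis
  obtain X where X: "bij_betw X {..<n} V"
    using ex_bij_betw_nat_finite[OF V] by (auto simp: n_def atLeast0LessThan)
  obtain Y where Y: "bij_betw Y {..<card F} F"
    using ex_bij_betw_nat_finite[OF F(1)] by (auto simp: atLeast0LessThan)
  define M where "M = mat n n (\<lambda>(i,j). if i < card F then a (Y i) (X j) else 0)"
  have M: "M \<in> carrier_mat n n" by (simp add: M_def)
  have "det M = 0"
  proof -
    have "det (transpose_mat M) = 0"
      unfolding det_0_iff_vec_prod_zero[OF transpose_carrier_mat[THEN iffD2, OF M]]
    proof (intro exI conjI)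
      \<comment> \<open>Row \<open>card F\<close> of \<open>M\<close> is the first padding row; it
        exists because \<open>card F < n\<close>.\<close>
      show "transpose_mat M *\<^sub>v unit_vec n (card F) = 0\<^sub>v n"
        by (rule eq_vecI) (use F in \<open>auto simp: M_def n_def\<close>)
      show "unit_vec n (card F) \<noteq> 0\<^sub>v n"
        using F(2) unfolding n_def by (metis index_unit_vec(1) index_zero_vec(1) zero_neq_one)
    qed simp
    then show ?thesis by (simp add: det_transpose[OF M])
  qed
  then obtain v where v: "v \<in> carrier_vec n" "v \<noteq> 0\<^sub>v n" "M *\<^sub>v v = 0\<^sub>v n"
    using det_0_iff_vec_prod_zero[OF M] by auto
  define f where "f u = v $ inv_into {..<n} X u" for u
  have fX: "f (X i) = v $ i" if "i < n" for i
    using X that by (simp add: f_def bij_betw_inv_into_left)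
  show ?thesis
  proof (rule that[of f])
    obtain i where i: "i < n" "v $ i \<noteq> 0" using v by (metis eq_vecI carrier_vecD index_zero_vec)
    then show "\<exists>u\<in>V. f u \<noteq> 0" using fX X by (metis bij_betwE lessThan_iff)
  next
    fix \<psi> assume \<psi>: "\<psi> \<in> F"
    then obtain i where i: "i < card F" "Y i = \<psi>" using Y by (metis bij_betw_iff_bijections lessThan_iff)
    have "\<psi> f = (\<Sum>j<n. a \<psi> (X j) * f (X j))"
      using a[OF \<psi>] sum.reindex_bij_betw[OF X, of "\<lambda>u. a \<psi> u * f u"] by simp
    also have "\<dots> = (M *\<^sub>v v) $ i"
      using i F(2) v(1) fX by (simp add: M_def n_def scalar_prod_def atLeast0LessThan)
    finally show "\<psi> f = 0" using v(3) i F(2) by (simp add: n_def)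
  qed
qed

text \<open>Sylvester's law of inertia, in a form dual to the usual one: instead of subspaces on which
  the form is definite, it takes sets of functionals on whose common kernel it is.\<close>

lemma signature_eqI:
  assumes fin: "finite (verts G)" "finite I" "finite J"
    and lin: "\<And>\<psi>. \<psi> \<in> I \<union> J \<Longrightarrow> linear_functional (verts G) \<psi>"
    and pos: "\<And>f. (\<And>\<psi>. \<psi> \<in> I \<Longrightarrow> \<psi> f = 0) \<Longrightarrow> \<exists>u\<in>verts G. f u \<noteq> 0 \<Longrightarrow> adjacency_form G f > 0"
    and neg: "\<And>f. (\<And>\<psi>. \<psi> \<in> J \<Longrightarrow> \<psi> f = 0) \<Longrightarrow> \<exists>u\<in>verts G. f u \<noteq> 0 \<Longrightarrow> adjacency_form G f < 0"
    and card: "card J \<le> p" "card I \<le> q" "p + q \<le> card (verts G)"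
  shows "signature G = int p - int q"
proof -
  define n where "n = card (verts G)"
  obtain d \<xi> where diag: "diagonalizes_adjacency G d \<xi>"
    using adjacency_form_diagonalization[OF fin(1)] .
  have \<xi>: "linear_functional (verts G) (\<xi> j)" if "j < n" for j
    using diag that unfolding diagonalizes_adjacency_def n_def by blast
  have form: "adjacency_form G f = (\<Sum>j<n. d j * (\<xi> j f)\<^sup>2)" for f
    using diag unfolding diagonalizes_adjacency_def n_def by blast
  have sig: "signature G = int (card {j. j < n \<and> d j > 0}) - int (card {j. j < n \<and> d j < 0})"
    using diag unfolding diagonalizes_adjacency_def n_def by blast
  define Pos where "Pos = {j. j < n \<and> d j > 0}"
  define Neg where "Neg = {j. j < n \<and> d j < 0}"
  \<comment> \<open>With fewer than \<open>n\<close> functionals in total, a nonzero function would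
    be annihilated by all of them, contrary to \<open>no\<close>.\<close>
  have bound: "n \<le> card K + card S"
    if K: "finite K" "\<And>\<psi>. \<psi> \<in> K \<Longrightarrow> linear_functional (verts G) \<psi>" and S: "S \<subseteq> {..<n}"
      and no: "\<And>f. (\<And>\<psi>. \<psi> \<in> K \<Longrightarrow> \<psi> f = 0) \<Longrightarrow> (\<And>j. j \<in> S \<Longrightarrow> \<xi> j f = 0) \<Longrightarrow> \<exists>u\<in>verts G. f u \<noteq> 0 \<Longrightarrow> False"
    for K S
  proof (rule ccontr)
    assume *: "\<not> n \<le> card K + card S"
    have finS: "finite S" using S by (rule finite_subset) simp
    have "card (K \<union> \<xi> ` S) \<le> card K + card S"
      using card_Un_le[of K "\<xi> ` S"] card_image_le[OF finS, of \<xi>] by linarith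
    with * have "card (K \<union> \<xi> ` S) < card (verts G)" by (simp add: n_def)
    moreover have "linear_functional (verts G) \<psi>" if "\<psi> \<in> K \<union> \<xi> ` S" for \<psi>
      using that K(2) \<xi> S by auto
    ultimately obtain f where "\<exists>u\<in>verts G. f u \<noteq> 0" "\<And>\<psi>. \<psi> \<in> K \<union> \<xi> ` S \<Longrightarrow> \<psi> f = 0"
      using linear_functionals_common_kernel[OF fin(1), of "K \<union> \<xi> ` S"] K(1) finS by blast
    then show False using no[of f] by blast
  qed
  \<comment> \<open>A nonzero function annihilated by \<open>I\<close> and by all
    \<open>\<xi> j\<close> with \<open>d j > 0\<close> would have a form value both positive and at
    most 0.\<close>
  have "n \<le> card I + card Pos"
  proof (rule bound)
    fix f assume 0: "\<And>\<psi>. \<psi> \<in> I \<Longrightarrow> \<psi> f = 0" "\<And>j. j \<in> Pos \<Longrightarrow> \<xi> j f = 0" "\<exists>u\<in>verts G. f u \<noteq> 0"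
    have "adjacency_form G f \<le> 0"
      unfolding form using 0(2) by (intro sum_nonpos) (force simp: Pos_def mult_le_0_iff)
    moreover have "adjacency_form G f > 0" by (rule pos) (use 0 in auto)
    ultimately show False by simp
  qed (use fin lin in \<open>auto simp: Pos_def\<close>)
  moreover have "n \<le> card J + card Neg"
  proof (rule bound)
    fix f assume 0: "\<And>\<psi>. \<psi> \<in> J \<Longrightarrow> \<psi> f = 0" "\<And>j. j \<in> Neg \<Longrightarrow> \<xi> j f = 0" "\<exists>u\<in>verts G. f u \<noteq> 0"
    have "adjacency_form G f \<ge> 0"
      unfolding form using 0(2) by (intro sum_nonneg) (force simp: Neg_def zero_le_mult_iff)
    moreover have "adjacency_form G f < 0" by (rule neg) (use 0 in auto)
    ultimately show False by simp
  qed (use fin lin in \<open>auto simp: Neg_def\<close>)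
  moreover have "card Pos + card Neg \<le> n"
  proof -
    have "card Pos + card Neg = card (Pos \<union> Neg)"
      by (rule card_Un_disjoint[symmetric]) (auto simp: Pos_def Neg_def)
    also have "\<dots> \<le> card {..<n}" by (rule card_mono) (auto simp: Pos_def Neg_def)
    finally show ?thesis by simp
  qed
  \<comment> \<open>Now \<open>card Pos \<ge> n - q \<ge> p\<close> and
    \<open>card Neg \<ge> n - p \<ge> q\<close>, while the two sizes add up to at most
    \<open>n\<close>; hence \<open>p + q = n\<close> and equality holds throughout.\<close>
  ultimately show ?thesis
    using card unfolding sig Pos_def[symmetric] Neg_def[symmetric] n_def[symmetric] by linarith
qed

section \<open>Closure properties of linear functionals\<close>

lemma linear_functional_eval:
  assumes "finite V" "u \<in> V"
  shows "linear_functional V (\<lambda>f. f u)"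
  unfolding linear_functional_def
proof (intro exI allI)
  fix f :: "'a \<Rightarrow> real"
  have "(\<Sum>w\<in>V. (if w = u then 1 else 0) * f w) = (\<Sum>w\<in>V. if w = u then f w else 0)"
    by (intro sum.cong) auto
  then show "f u = (\<Sum>w\<in>V. (if w = u then 1 else 0) * f w)" using assms by simp
qed

lemma linear_functional_zero: "linear_functional V (\<lambda>f. 0)"
  unfolding linear_functional_def by (rule exI[of _ "\<lambda>_. 0"]) simp

lemma linear_functional_add:
  assumes "linear_functional V \<phi>" "linear_functional V \<psi>"
  shows "linear_functional V (\<lambda>f. \<phi> f + \<psi> f)"
proof -
  obtain a b where "\<And>f. \<phi> f = (\<Sum>u\<in>V. a u * f u)" "\<And>f. \<psi> f = (\<Sum>u\<in>V. b u * f u)"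
    using assms unfolding linear_functional_def by auto
  then have "\<forall>f. \<phi> f + \<psi> f = (\<Sum>u\<in>V. (a u + b u) * f u)"
    by (simp add: distrib_right sum.distrib)
  then show ?thesis unfolding linear_functional_def by (rule exI[of _ "\<lambda>u. a u + b u"])
qed

lemma linear_functional_scale:
  assumes "linear_functional V \<phi>"
  shows "linear_functional V (\<lambda>f. c * \<phi> f)"
proof -
  obtain a where "\<And>f. \<phi> f = (\<Sum>u\<in>V. a u * f u)"
    using assms unfolding linear_functional_def by auto
  then have "\<forall>f. c * \<phi> f = (\<Sum>u\<in>V. (c * a u) * f u)"
    by (simp add: sum_distrib_left mult_ac)
  then show ?thesis unfolding linear_functional_def by (rule exI[of _ "\<lambda>u. c * a u"])
qed

lemma linear_functional_sum:
  assumes "\<And>i. i \<in> S \<Longrightarrow> linear_functional V (\<phi> i)"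
  shows "linear_functional V (\<lambda>f. \<Sum>i\<in>S. \<phi> i f)"
  using assms
  by (induction S rule: infinite_finite_induct)
    (simp_all add: linear_functional_zero linear_functional_add)

section \<open>Quadratic forms of line graphs\<close>

text \<open>The incidence matrix \<open>N\<close> applied to a vector indexed by edges.\<close>

definition edge_sum :: "'a ugraph \<Rightarrow> ('a set \<Rightarrow> real) \<Rightarrow> 'a \<Rightarrow> real" where
  "edge_sum G f w = (\<Sum>e\<in>edges G. if w \<in> e then f e else 0)"

text \<open>The transpose \<open>N^T\<close> applied to a vector indexed by vertices. The graph is
  no parameter because an edge is the set of its endpoints.\<close>

definition end_sum :: "('a \<Rightarrow> real) \<Rightarrow> 'a set \<Rightarrow> real" where
  "end_sum g e = (\<Sum>u\<in>e. g u)"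

lemma verts_line_graph [simp]: "verts (line_graph G) = edges G"
  by (simp add: line_graph_def)

lemma edges_line_graph:
  "e \<in> edges G \<Longrightarrow> f \<in> edges G \<Longrightarrow> {e, f} \<in> edges (line_graph G) \<longleftrightarrow> e \<noteq> f \<and> e \<inter> f \<noteq> {}"
  unfolding line_graph_def by (auto simp: doubleton_eq_iff)

lemma edge_subset_verts: "simple_graph G \<Longrightarrow> e \<in> edges G \<Longrightarrow> e \<subseteq> verts G"
  by (simp add: simple_graph_def)

lemma card_edge: "simple_graph G \<Longrightarrow> e \<in> edges G \<Longrightarrow> card e = 2"
  by (simp add: simple_graph_def)

lemma finite_verts: "simple_graph G \<Longrightarrow> finite (verts G)"
  by (simp add: simple_graph_def)

lemma end_sum_eq:
  assumes "simple_graph G" "e \<in> edges G"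
  shows "end_sum g e = (\<Sum>u\<in>verts G. if u \<in> e then g u else 0)"
  unfolding end_sum_def using edge_subset_verts[OF assms] finite_verts[OF assms(1)]
  by (simp add: sum.If_cases Int_absorb1)

text \<open>Exchanging the two summations over incident pairs gives the adjointness of
  \<open>N\<close> and \<open>N^T\<close>, which turns sums over vertices into sums over
  edges.\<close>

lemma edge_sum_adjoint:
  assumes G: "simple_graph G"
  shows "(\<Sum>w\<in>verts G. h w * edge_sum G f w) = (\<Sum>e\<in>edges G. end_sum h e * f e)"
proof -
  have "(\<Sum>w\<in>verts G. h w * edge_sum G f w)
      = (\<Sum>w\<in>verts G. \<Sum>e\<in>edges G. (if w \<in> e then h w else 0) * f e)"
    unfolding edge_sum_def sum_distrib_left by (intro sum.cong) auto
  also have "\<dots> = (\<Sum>e\<in>edges G. \<Sum>w\<in>verts G. (if w \<in> e then h w else 0) * f e)"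
    by (rule sum.swap)
  also have "\<dots> = (\<Sum>e\<in>edges G. end_sum h e * f e)"
    by (intro sum.cong refl) (simp add: end_sum_eq[OF G] sum_distrib_right)
  finally show ?thesis .
qed

text \<open>These are the entries of \<open>N^T N\<close>: distinct sets of size 2 share at most one
  element.\<close>

lemma card_edge_Int:
  assumes G: "simple_graph G" and e: "e \<in> edges G" "f \<in> edges G"
  shows "real (card (e \<inter> f))
    = (if {e, f} \<in> edges (line_graph G) then 1 else 0) + (if e = f then 2 else 0)"
proof (cases "e = f")
  case True
  then show ?thesis using card_edge[OF G e(1)] edges_line_graph[OF e] by simp
next
  case False
  have fin: "finite e" "finite f" using card_edge[OF G] e by (auto intro: card_ge_0_finite)
  have "card (e \<inter> f) \<noteq> 2"
    using False card_edge[OF G] e fin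
    by (metis card_subset_eq inf.cobounded1 inf.cobounded2)
  moreover have "card (e \<inter> f) \<le> 2"
    using card_mono[OF fin(1), of "e \<inter> f"] card_edge[OF G e(1)] by simp
  ultimately have "card (e \<inter> f) = (if e \<inter> f = {} then 0 else 1)"
    using fin by (auto simp: le_Suc_eq numeral_2_eq_2)
  then show ?thesis using False edges_line_graph[OF e] by simp
qed

text \<open>This is \<open>N^T N = A(L(G)) + 2I\<close>, applied to \<open>f\<close>.\<close>

lemma end_sum_edge_sum:
  assumes G: "simple_graph G" and e: "e \<in> edges G"
  shows "end_sum (edge_sum G f) e
    = (\<Sum>e'\<in>edges G. if {e, e'} \<in> edges (line_graph G) then f e' else 0) + 2 * f e"
proof -
  have "end_sum (edge_sum G f) e = (\<Sum>e'\<in>edges G. \<Sum>u\<in>e. if u \<in> e' then f e' else 0)"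
    unfolding end_sum_def edge_sum_def by (rule sum.swap)
  also have "\<dots> = (\<Sum>e'\<in>edges G. real (card (e \<inter> e')) * f e')"
    using card_edge[OF G e] by (intro sum.cong refl) (simp add: sum.If_cases card_ge_0_finite)
  also have "\<dots> = (\<Sum>e'\<in>edges G. (if {e, e'} \<in> edges (line_graph G) then f e' else 0)
      + (if e = e' then 2 * f e' else 0))"
    by (intro sum.cong refl) (simp add: card_edge_Int[OF G e])
  finally show ?thesis using e finite_edges[OF G] by (simp add: sum.distrib)
qed

text \<open>By adjointness \<open>|N f|^2\<close> is the quadratic form of \<open>N^T N\<close>,
  which exceeds that of \<open>A(L(G))\<close> by \<open>2 |f|^2\<close>.\<close>

lemma adjacency_form_line_graph:
  assumes G: "simple_graph G"
  shows "adjacency_form (line_graph G) f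
    = (\<Sum>w\<in>verts G. (edge_sum G f w)\<^sup>2) - 2 * (\<Sum>e\<in>edges G. (f e)\<^sup>2)"
proof -
  have "(\<Sum>w\<in>verts G. (edge_sum G f w)\<^sup>2) = (\<Sum>e\<in>edges G. end_sum (edge_sum G f) e * f e)"
    using edge_sum_adjoint[OF G, of "edge_sum G f" f] by (simp add: power2_eq_square)
  also have "\<dots> = (\<Sum>e\<in>edges G. (\<Sum>e'\<in>edges G. if {e, e'} \<in> edges (line_graph G) then f e * f e' else 0)
      + 2 * (f e)\<^sup>2)"
    by (intro sum.cong refl)
      (auto simp: end_sum_edge_sum[OF G] algebra_simps sum_distrib_left power2_eq_square intro!: sum.cong)
  finally show ?thesis
    by (simp add: adjacency_form_def sum.distrib sum_distrib_left)
qed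

text \<open>This is \<open>N N^T = Q(G)\<close>: the entry at \<open>(w, u)\<close> counts the edges
  through both vertices, which is the degree if \<open>u = w\<close> and otherwise 1 or 0.\<close>

lemma edge_sum_end_sum:
  assumes G: "simple_graph G" and w: "w \<in> verts G"
  shows "edge_sum G (end_sum g) w
    = (\<Sum>u\<in>verts G. if {w, u} \<in> edges G then g u else 0) + real (vertex_degree G w) * g w"
proof -
  have "edge_sum G (end_sum g) w = (\<Sum>e\<in>edges G. \<Sum>u\<in>verts G. if w \<in> e \<and> u \<in> e then g u else 0)"
    unfolding edge_sum_def by (intro sum.cong refl) (simp add: end_sum_eq[OF G])
  also have "\<dots> = (\<Sum>u\<in>verts G. \<Sum>e\<in>edges G. if w \<in> e \<and> u \<in> e then g u else 0)"
    by (rule sum.swap)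
  also have "\<dots> = (\<Sum>u\<in>verts G. (if {w, u} \<in> edges G then g u else 0)
      + (if u = w then real (vertex_degree G w) * g u else 0))"
  proof (intro sum.cong refl)
    fix u
    have "(\<Sum>e\<in>edges G. if w \<in> e \<and> u \<in> e then g u else 0) = real (card {e \<in> edges G. w \<in> e \<and> u \<in> e}) * g u"
      using finite_edges[OF G] by (simp add: sum.If_cases Int_def)
    also have "\<dots> = (if {w, u} \<in> edges G then g u else 0) + (if u = w then real (vertex_degree G w) * g u else 0)"
    proof (cases "u = w")
      case True
      \<comment> \<open>Here \<open>{w, u}\<close> collapses to \<open>{w}\<close>, which is no
        edge, so the adjacency term is 0.\<close>
      then show ?thesis using card_edge[OF G, of "{w}"] by (auto simp: vertex_degree_def)
    next
      case False
      have "e = {w, u}" if "e \<in> edges G" "w \<in> e" "u \<in> e" for e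
        using card_edge[OF G that(1)] that False by (auto simp: card_2_iff)
      then have "{e \<in> edges G. w \<in> e \<and> u \<in> e} = {e \<in> edges G. e = {w, u}}"
        by blast
      also have "\<dots> = (if {w, u} \<in> edges G then {{w, u}} else {})"
        by (simp add: Collect_conv_if2 conj_commute cong: conj_cong)
      finally have "{e \<in> edges G. w \<in> e \<and> u \<in> e} = \<dots>" .
      then show ?thesis using False by simp
    qed
    finally show "(\<Sum>e\<in>edges G. if w \<in> e \<and> u \<in> e then g u else 0)
      = (if {w, u} \<in> edges G then g u else 0) + (if u = w then real (vertex_degree G w) * g u else 0)" .
  qed
  finally show ?thesis using w finite_verts[OF G] by (simp add: sum.distrib)
qed

section \<open>The signless Laplacian and its resolvent at 2\<close>

lemma signless_laplacian_carrier: "signless_laplacian G \<in> carrier_mat (card (verts G)) (card (verts G))"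
  by (simp add: signless_laplacian_def adjacency_matrix_def degree_matrix_def)

lemma signless_laplacian_mult_vec:
  assumes G: "simple_graph G" and i: "i < card (verts G)"
  shows "(signless_laplacian G *\<^sub>v vec (card (verts G)) (\<lambda>i. g (vertex_list G ! i))) $ i
    = edge_sum G (end_sum g) (vertex_list G ! i)"
proof -
  let ?n = "card (verts G)" and ?X = "(!) (vertex_list G)"
  note fin = finite_verts[OF G]
  have w: "?X i \<in> verts G" using i vertex_list[OF fin] by (metis nth_mem)
  have "(signless_laplacian G *\<^sub>v vec ?n (\<lambda>i. g (?X i))) $ i
      = (\<Sum>j<?n. (if {?X i, ?X j} \<in> edges G then g (?X j) else 0)
          + (if i = j then real (vertex_degree G (?X i)) * g (?X j) else 0))"
  proof -
    have "(signless_laplacian G *\<^sub>v vec ?n (\<lambda>i. g (?X i))) $ i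
        = (\<Sum>j<?n. ((if {?X i, ?X j} \<in> edges G then 1 else 0)
            + (if i = j then real (vertex_degree G (?X i)) else 0)) * g (?X j))"
      using i unfolding signless_laplacian_def adjacency_matrix_def degree_matrix_def
      by (simp add: scalar_prod_def atLeast0LessThan)
    also have "\<dots> = (\<Sum>j<?n. (if {?X i, ?X j} \<in> edges G then g (?X j) else 0)
          + (if i = j then real (vertex_degree G (?X i)) * g (?X j) else 0))"
      by (intro sum.cong refl) (simp add: distrib_right)
    finally show ?thesis .
  qed
  also have "\<dots> = edge_sum G (end_sum g) (?X i)"
    unfolding edge_sum_end_sum[OF G w] sum_verts[OF fin] using i by (simp add: sum.distrib)
  finally show ?thesis .
qed

text \<open>The witness \<open>h\<close> is the column of \<open>(Q(G) - 2I)^-1\<close> belonging to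
  \<open>v\<close>; its entry at \<open>v\<close> is \<open>phi G v\<close> by definition.\<close>

lemma phi_solution:
  assumes G: "simple_graph G" and ev: "\<not> eigenvalue (signless_laplacian G) 2" and v: "v \<in> verts G"
  obtains h where "h v = phi G v"
    "\<And>w. w \<in> verts G \<Longrightarrow> edge_sum G (end_sum h) w = 2 * h w + (if w = v then 1 else 0)"
proof -
  define n where "n = card (verts G)"
  define Q where "Q = signless_laplacian G"
  define M where "M = Q - 2 \<cdot>\<^sub>m 1\<^sub>m n"
  note fin = finite_verts[OF G]
  have Q: "Q \<in> carrier_mat n n" using signless_laplacian_carrier by (simp add: Q_def n_def)
  have M: "M \<in> carrier_mat n n" unfolding M_def using Q by (intro minus_carrier_mat) simp
  have "char_matrix Q 2 = M"
    by (rule eq_matI) (use Q in \<open>auto simp: char_matrix_def M_def\<close>)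
  then have "det M \<noteq> 0" using ev eigenvalue_det[OF Q, of 2] by (simp add: Q_def)
  then have "M \<in> Units (ring_mat TYPE(real) n ())" by (rule det_non_zero_imp_unit[OF M])
  \<comment> \<open>Invertibility rules out \<open>None\<close>, so \<open>phi\<close> reads an
    entry of a genuine inverse.\<close>
  then obtain R where R: "mat_inverse M = Some R"
    using mat_inverse(1)[OF M, of "()"] by (cases "mat_inverse M") auto
  then have MR: "M * R = 1\<^sub>m n" "R \<in> carrier_mat n n" using mat_inverse(2)[OF M] by auto
  define iv where "iv = vertex_index G v"
  have iv: "iv < n" "vertex_list G ! iv = v" using vertex_index[OF fin v] by (simp_all add: iv_def n_def)
  define h where "h w = R $$ (vertex_index G w, iv)" for w
  have col: "vec n (\<lambda>i. h (vertex_list G ! i)) = col R iv"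
    by (rule eq_vecI) (use MR iv vertex_index_nth[OF fin] in \<open>auto simp: h_def n_def\<close>)
  show ?thesis
  proof (rule that[of h])
    show "h v = phi G v" unfolding phi_def
      using R by (simp add: h_def iv_def M_def Q_def n_def)
  next
    fix w assume w: "w \<in> verts G"
    define i where "i = vertex_index G w"
    have i: "i < n" "vertex_list G ! i = w" using vertex_index[OF fin w] by (simp_all add: i_def n_def)
    have "(M *\<^sub>v col R iv) $ i = (M * R) $$ (i, iv)"
      using M MR(2) i iv by simp
    also have "\<dots> = (if i = iv then 1 else 0)" unfolding MR(1) using i(1) iv(1) by simp
    also have "i = iv \<longleftrightarrow> w = v" using i(2) iv(2) by (metis i_def iv_def)
    finally have 1: "(M *\<^sub>v col R iv) $ i = (if w = v then 1 else 0)" .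
    have "M *\<^sub>v col R iv = Q *\<^sub>v col R iv - 2 \<cdot>\<^sub>v col R iv"
    proof -
      have "(2 \<cdot>\<^sub>m 1\<^sub>m n) *\<^sub>v col R iv = 2 \<cdot>\<^sub>v col R iv"
        by (rule eq_vecI) (use MR(2) in auto)
      then show ?thesis
        unfolding M_def using minus_mult_distrib_mat_vec[OF Q, of "2 \<cdot>\<^sub>m 1\<^sub>m n" "col R iv"] MR(2) iv(1)
        by simp
    qed
    then have "(Q *\<^sub>v col R iv) $ i = 2 * col R iv $ i + (if w = v then 1 else 0)"
      using 1 Q MR(2) i by (simp del: index_mult_mat_vec)
    moreover have "(Q *\<^sub>v col R iv) $ i = edge_sum G (end_sum h) w"
      using signless_laplacian_mult_vec[OF G, of i h] i col by (simp add: Q_def n_def)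
    moreover have "col R iv $ i = h w" using i by (simp add: col[symmetric])
    ultimately show "edge_sum G (end_sum h) w = 2 * h w + (if w = v then 1 else 0)" by simp
  qed
qed

text \<open>If \<open>A(L(G)) f = 0\<close> then \<open>N^T N f = 2 f\<close>, so
  \<open>Q(G)\<close> maps \<open>N f\<close> to \<open>2 N f\<close>. The contrapositive makes the
  form of the line graph nondegenerate.\<close>

lemma eigenvalue_line_graph_0:
  assumes G: "simple_graph G" and ev: "eigenvalue (adjacency_matrix (line_graph G)) 0"
  shows "eigenvalue (signless_laplacian G) 2"
proof -
  let ?L = "line_graph G" and ?n = "card (verts G)"
  note finE = finite_edges[OF G] and finV = finite_verts[OF G]
  have finL: "finite (verts ?L)" using finE by simp
  define m where "m = card (edges G)"
  have A: "adjacency_matrix ?L \<in> carrier_mat m m" by (simp add: adjacency_matrix_def m_def)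
  obtain x where x: "x \<in> carrier_vec m" "x \<noteq> 0\<^sub>v m" "adjacency_matrix ?L *\<^sub>v x = 0 \<cdot>\<^sub>v x"
    using ev A unfolding eigenvalue_def eigenvector_def by auto
  define f where "f e = x $ vertex_index ?L e" for e
  have fX: "f (vertex_list ?L ! i) = x $ i" if "i < m" for i
    using vertex_index_nth[OF finL] that by (simp add: f_def m_def)
  have 0: "(\<Sum>e'\<in>edges G. if {e, e'} \<in> edges ?L then f e' else 0) = 0" if e: "e \<in> edges G" for e
  proof -
    define i where "i = vertex_index ?L e"
    have i: "i < m" "vertex_list ?L ! i = e"
      using vertex_index[OF finL, of e] e by (simp_all add: i_def m_def)
    have "0 = (adjacency_matrix ?L *\<^sub>v x) $ i" unfolding x(3) using i x(1) by simp
    also have "\<dots> = (\<Sum>j<m. (if {e, vertex_list ?L ! j} \<in> edges ?L then 1 else 0) * x $ j)"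
      using i x(1) by (simp add: adjacency_matrix_def scalar_prod_def atLeast0LessThan m_def)
    also have "\<dots> = (\<Sum>j<m. if {e, vertex_list ?L ! j} \<in> edges ?L then f (vertex_list ?L ! j) else 0)"
      by (intro sum.cong) (auto simp: fX)
    also have "\<dots> = (\<Sum>e'\<in>edges G. if {e, e'} \<in> edges ?L then f e' else 0)"
      using sum_verts[OF finL, of "\<lambda>e'. if {e, e'} \<in> edges ?L then f e' else 0"] by (simp add: m_def)
    finally show ?thesis by simp
  qed
  define g where "g = edge_sum G f"
  have g: "end_sum g e = 2 * f e" if "e \<in> edges G" for e
    using end_sum_edge_sum[OF G that, of f] 0[OF that] by (simp add: g_def)
  have Qg: "edge_sum G (end_sum g) w = 2 * g w" for w
  proof -
    have "edge_sum G (end_sum g) w = (\<Sum>e\<in>edges G. 2 * (if w \<in> e then f e else 0))"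
      unfolding edge_sum_def by (intro sum.cong) (auto simp: g)
    then show ?thesis by (simp add: g_def edge_sum_def sum_distrib_left)
  qed
  define y where "y = vec ?n (\<lambda>i. g (vertex_list G ! i))"
  have "signless_laplacian G *\<^sub>v y = 2 \<cdot>\<^sub>v y"
    by (rule eq_vecI)
      (use signless_laplacian_mult_vec[OF G] signless_laplacian_carrier[of G] in
        \<open>auto simp: y_def Qg simp del: index_mult_mat_vec(1)\<close>)
  \<comment> \<open>If \<open>N f\<close> vanished, so would \<open>N^T N f = 2 f\<close>.\<close>
  moreover have "y \<noteq> 0\<^sub>v ?n"
  proof
    assume "y = 0\<^sub>v ?n"
    then have "g w = 0" if "w \<in> verts G" for w
      using vertex_index[OF finV that] unfolding y_def by (metis index_vec index_zero_vec(1))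
    then have "f e = 0" if "e \<in> edges G" for e
      using g[OF that] end_sum_eq[OF G that, of g] by simp
    then have "x = 0\<^sub>v m"
      using x(1) fX vertex_list[OF finL] by (intro eq_vecI) (auto simp: m_def, metis nth_mem)
    with x(2) show False by simp
  qed
  moreover have "y \<in> carrier_vec ?n" by (simp add: y_def)
  ultimately show ?thesis
    using signless_laplacian_carrier[of G] unfolding eigenvalue_def eigenvector_def by auto
qed

text \<open>Completing the square: the shift by \<open>c * end_sum h\<close> removes the cross term between the edges
  of \<open>G\<close> and a pendant contribution \<open>c\<close> at \<open>v\<close>.\<close>

lemma line_graph_form_shift:
  assumes G: "simple_graph G" and v: "v \<in> verts G"
    and h: "\<And>w. w \<in> verts G \<Longrightarrow> edge_sum G (end_sum h) w = 2 * h w + (if w = v then 1 else 0)"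
  shows "(\<Sum>w\<in>verts G. (edge_sum G x w + (if w = v then c else 0))\<^sup>2) - 2 * (\<Sum>e\<in>edges G. (x e)\<^sup>2)
    = adjacency_form (line_graph G) (\<lambda>e. x e + c * end_sum h e) - 2 * h v * c\<^sup>2"
proof -
  note fin = finite_verts[OF G]
  define X where "X w = edge_sum G x w + (if w = v then c else 0)" for w
  have S: "edge_sum G (\<lambda>e. x e + c * end_sum h e) w = X w + 2 * c * h w" if "w \<in> verts G" for w
  proof -
    have "edge_sum G (\<lambda>e. x e + c * end_sum h e) w = edge_sum G x w + c * edge_sum G (end_sum h) w"
      unfolding edge_sum_def sum_distrib_left sum.distrib[symmetric] by (intro sum.cong) auto
    then show ?thesis by (simp add: h[OF that] X_def algebra_simps)
  qed
  have hX: "(\<Sum>w\<in>verts G. h w * X w) = (\<Sum>e\<in>edges G. end_sum h e * x e) + c * h v"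
  proof -
    have "(\<Sum>w\<in>verts G. h w * X w)
        = (\<Sum>w\<in>verts G. h w * edge_sum G x w + (if w = v then c * h w else 0))"
      by (intro sum.cong) (auto simp: X_def algebra_simps)
    then show ?thesis using v fin by (simp add: sum.distrib edge_sum_adjoint[OF G])
  qed
  \<comment> \<open>By adjointness \<open>|N^T h|^2\<close> is the scalar product of
    \<open>h\<close> with \<open>Q(G) h = 2 h + e_v\<close>.\<close>
  have tt: "(\<Sum>e\<in>edges G. (end_sum h e)\<^sup>2) = 2 * (\<Sum>w\<in>verts G. (h w)\<^sup>2) + h v"
  proof -
    have "(\<Sum>e\<in>edges G. (end_sum h e)\<^sup>2) = (\<Sum>w\<in>verts G. h w * edge_sum G (end_sum h) w)"
      by (simp add: edge_sum_adjoint[OF G] power2_eq_square)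
    also have "\<dots> = (\<Sum>w\<in>verts G. 2 * (h w)\<^sup>2 + (if w = v then h w else 0))"
      by (intro sum.cong) (auto simp: h power2_eq_square algebra_simps)
    finally show ?thesis using v fin by (simp add: sum.distrib sum_distrib_left)
  qed
  have "(\<Sum>w\<in>verts G. (edge_sum G (\<lambda>e. x e + c * end_sum h e) w)\<^sup>2)
      = (\<Sum>w\<in>verts G. (X w)\<^sup>2 + 4 * c * (h w * X w) + 4 * c\<^sup>2 * (h w)\<^sup>2)"
    by (intro sum.cong refl) (simp add: S power2_eq_square algebra_simps)
  also have "\<dots> = (\<Sum>w\<in>verts G. (X w)\<^sup>2) + 4 * c * (\<Sum>w\<in>verts G. h w * X w) + 4 * c\<^sup>2 * (\<Sum>w\<in>verts G. (h w)\<^sup>2)"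
    by (simp only: sum.distrib sum_distrib_left)
  finally have 1: "(\<Sum>w\<in>verts G. (edge_sum G (\<lambda>e. x e + c * end_sum h e) w)\<^sup>2) = \<dots>" .
  have "(\<Sum>e\<in>edges G. (x e + c * end_sum h e)\<^sup>2)
      = (\<Sum>e\<in>edges G. (x e)\<^sup>2 + 2 * c * (end_sum h e * x e) + c\<^sup>2 * (end_sum h e)\<^sup>2)"
    by (intro sum.cong refl) (simp add: power2_eq_square algebra_simps)
  also have "\<dots> = (\<Sum>e\<in>edges G. (x e)\<^sup>2) + 2 * c * (\<Sum>e\<in>edges G. end_sum h e * x e)
      + c\<^sup>2 * (\<Sum>e\<in>edges G. (end_sum h e)\<^sup>2)"
    by (simp only: sum.distrib sum_distrib_left)
  \<comment> \<open>The terms mixing \<open>x\<close> with \<open>h\<close> and those in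
    \<open>|h|^2\<close> cancel; what remains is
    \<open>4 c^2 h(v) - 2 c^2 h(v) = 2 c^2 h(v)\<close>.\<close>
  finally show ?thesis
    unfolding adjacency_form_line_graph[OF G] 1 hX tt X_def[symmetric]
    by (simp add: algebra_simps power2_eq_square)
qed

section \<open>Chains of copies\<close>

definition bridge :: "'a \<Rightarrow> nat \<Rightarrow> (nat \<times> 'a) set" where
  "bridge v i = {(i, v), (i + 1, v)}"

text \<open>This is \<open>c_i = y_i + y_(i-1)\<close>; the guards encode
  \<open>y_0 = y_k = 0\<close>, as the end copies lack a bridge on one side.\<close>

definition bridge_load :: "'a \<Rightarrow> nat \<Rightarrow> ((nat \<times> 'a) set \<Rightarrow> real) \<Rightarrow> nat \<Rightarrow> real" where
  "bridge_load v k f i = (if i < k then f (bridge v i) else 0) + (if 2 \<le> i then f (bridge v (i - 1)) else 0)"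

lemma edges_chain_graph:
  "edges (chain_graph B v k)
    = (\<lambda>(i, e). Pair i ` e) ` ({1..k} \<times> edges B) \<union> bridge v ` {1..<k}"
  unfolding chain_graph_def bridge_def by (force simp: image_iff)

text \<open>A copied edge has one first component and a bridge has two, so the two families are
  disjoint; both are parametrized injectively.\<close>

lemma sum_edges_chain_graph:
  assumes B: "simple_graph B"
  shows "(\<Sum>e\<in>edges (chain_graph B v k). F e)
    = (\<Sum>i\<in>{1..k}. \<Sum>e\<in>edges B. F (Pair i ` e)) + (\<Sum>i\<in>{1..<k}. F (bridge v i))"
proof -
  let ?c = "\<lambda>(i, e). Pair i ` e :: (nat \<times> 'a) set"
  note finE = finite_edges[OF B]
  \<comment> \<open>The index \<open>i\<close> can be read off \<open>Pair i\<close> followed by the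
    image of \<open>e\<close> only if \<open>e\<close> is nonempty.\<close>
  have ne: "e \<noteq> {}" if "e \<in> edges B" for e
    using card_edge[OF B that] by auto
  have inj_c: "inj_on ?c ({1..k} \<times> edges B)"
  proof (rule inj_onI, clarify)
    fix i e j e' assume e: "e \<in> edges B" "e' \<in> edges B" and eq: "Pair i ` e = Pair j ` e'"
    have "fst ` Pair i ` e = {i}" "fst ` Pair j ` e' = {j}"
      using ne e by (auto simp: image_image)
    moreover have "snd ` Pair i ` e = e" "snd ` Pair j ` e' = e'" by (auto simp: image_image)
    ultimately show "i = j \<and> e = e'" using eq by (metis singleton_inject)
  qed
  have inj_b: "inj_on (bridge v) {1..<k}"
    by (rule inj_onI) (auto simp: bridge_def doubleton_eq_iff)
  have "?c ` ({1..k} \<times> edges B) \<inter> bridge v ` {1..<k} = {}"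
  proof -
    have "Pair i ` e \<noteq> bridge v j" for i j e
    proof
      assume "Pair i ` e = bridge v j"
      then have "(j, v) \<in> Pair i ` e" "(j + 1, v) \<in> Pair i ` e" by (auto simp: bridge_def)
      then show False by auto
    qed
    then show ?thesis by auto
  qed
  then have "(\<Sum>e\<in>edges (chain_graph B v k). F e)
      = (\<Sum>e\<in>?c ` ({1..k} \<times> edges B). F e) + (\<Sum>e\<in>bridge v ` {1..<k}. F e)"
    unfolding edges_chain_graph using finE by (intro sum.union_disjoint) auto
  also have "(\<Sum>e\<in>?c ` ({1..k} \<times> edges B). F e) = (\<Sum>p\<in>{1..k} \<times> edges B. F (?c p))"
    using inj_c by (simp add: sum.reindex)
  also have "\<dots> = (\<Sum>i\<in>{1..k}. \<Sum>e\<in>edges B. F (Pair i ` e))"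
    by (simp add: sum.cartesian_product case_prod_unfold)
  also have "(\<Sum>e\<in>bridge v ` {1..<k}. F e) = (\<Sum>i\<in>{1..<k}. F (bridge v i))"
    using inj_b by (simp add: sum.reindex)
  finally show ?thesis .
qed

lemma edge_sum_chain_graph:
  assumes B: "simple_graph B" and i: "i \<in> {1..k}"
  shows "edge_sum (chain_graph B v k) f (i, u)
    = edge_sum B (\<lambda>e. f (Pair i ` e)) u + (if u = v then bridge_load v k f i else 0)"
proof -
  have "(\<Sum>j\<in>{1..k}. \<Sum>e\<in>edges B. if (i, u) \<in> Pair j ` e then f (Pair j ` e) else 0)
      = (\<Sum>j\<in>{1..k}. if j = i then edge_sum B (\<lambda>e. f (Pair j ` e)) u else 0)"
    unfolding edge_sum_def by (intro sum.cong refl) (auto intro!: sum.cong sum.neutral)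
  also have "\<dots> = edge_sum B (\<lambda>e. f (Pair i ` e)) u" using i by simp
  \<comment> \<open>The bridges at \<open>(i, v)\<close> have index \<open>i\<close> or
    \<open>i - 1\<close>. These differ because \<open>i \<ge> 1\<close>, and an index outside
    \<open>{1..<k}\<close> contributes nothing.\<close>
  moreover have "(\<Sum>j\<in>{1..<k}. if (i, u) \<in> bridge v j then f (bridge v j) else 0)
      = (\<Sum>j\<in>{1..<k}. (if j = i then (if u = v then f (bridge v j) else 0) else 0)
          + (if j = i - 1 then (if u = v then f (bridge v j) else 0) else 0))"
    using i by (intro sum.cong refl) (auto simp: bridge_def)
  then have "(\<Sum>j\<in>{1..<k}. if (i, u) \<in> bridge v j then f (bridge v j) else 0)
      = (if u = v then bridge_load v k f i else 0)"
    using i by (auto simp: sum.distrib bridge_load_def)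
  ultimately show ?thesis
    unfolding edge_sum_def[of "chain_graph B v k"] sum_edges_chain_graph[OF B] by simp
qed

text \<open>Completing the square in each copy, with its bridge load as \<open>c\<close>, decouples
  the copies: the bridge values survive only in the shifts and in separate squares.\<close>

lemma adjacency_form_chain_graph:
  assumes B: "simple_graph B" and v: "v \<in> verts B"
    and h: "\<And>w. w \<in> verts B \<Longrightarrow> edge_sum B (end_sum h) w = 2 * h w + (if w = v then 1 else 0)"
  shows "adjacency_form (line_graph (chain_graph B v k)) f
    = (\<Sum>i\<in>{1..k}. adjacency_form (line_graph B)
          (\<lambda>e. f (Pair i ` e) + bridge_load v k f i * end_sum h e))
      - 2 * h v * (\<Sum>i\<in>{1..k}. (bridge_load v k f i)\<^sup>2) - 2 * (\<Sum>i\<in>{1..<k}. (f (bridge v i))\<^sup>2)"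
proof -
  let ?C = "chain_graph B v k" and ?c = "bridge_load v k f"
  let ?x = "\<lambda>i e. f (Pair i ` e)"
  have "(\<Sum>w\<in>verts ?C. (edge_sum ?C f w)\<^sup>2) = (\<Sum>i\<in>{1..k}. \<Sum>u\<in>verts B. (edge_sum ?C f (i, u))\<^sup>2)"
    by (simp add: chain_graph_def sum.cartesian_product case_prod_unfold)
  also have "\<dots> = (\<Sum>i\<in>{1..k}. \<Sum>u\<in>verts B. (edge_sum B (?x i) u + (if u = v then ?c i else 0))\<^sup>2)"
    by (intro sum.cong refl) (simp add: edge_sum_chain_graph[OF B])
  finally have "adjacency_form (line_graph ?C) f
      = (\<Sum>i\<in>{1..k}. (\<Sum>u\<in>verts B. (edge_sum B (?x i) u + (if u = v then ?c i else 0))\<^sup>2)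
          - 2 * (\<Sum>e\<in>edges B. (?x i e)\<^sup>2)) - 2 * (\<Sum>i\<in>{1..<k}. (f (bridge v i))\<^sup>2)"
    unfolding adjacency_form_line_graph[OF simple_graph_chain_graph[OF B v]] sum_edges_chain_graph[OF B]
    by (simp add: sum_subtractf sum_distrib_left)
  also have "\<dots> = (\<Sum>i\<in>{1..k}. adjacency_form (line_graph B) (\<lambda>e. ?x i e + ?c i * end_sum h e)
        - 2 * h v * (?c i)\<^sup>2) - 2 * (\<Sum>i\<in>{1..<k}. (f (bridge v i))\<^sup>2)"
    by (simp only: line_graph_form_shift[OF B v h])
  finally show ?thesis by (simp add: sum_subtractf sum_distrib_left)
qed

section \<open>Inertia of the line graph of the chain\<close>

theorem theorem5:
  fixes B :: "'a ugraph" and v :: 'a and n m :: nat and \<sigma> :: int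
  assumes "simple_graph B"
    and "card (verts B) = n"
    and "card (edges B) = m"
    and "m \<ge> n"
    and "\<sigma> = signature (line_graph B)"
    and "\<not> eigenvalue (signless_laplacian B) 2"
    and "v \<in> verts B"
    and "phi B v > 0"
  shows "\<forall>k\<ge>1. signature (line_graph (chain_graph B v k)) = int k * \<sigma> - (int k - 1)"
proof (intro allI impI)
  fix k :: nat assume k: "k \<ge> 1"
  note B = assms(1) and v = assms(7)
  let ?C = "chain_graph B v k"
  have C: "simple_graph ?C" by (rule simple_graph_chain_graph[OF B v])
  have fin: "finite (verts (line_graph B))" using finite_edges[OF B] by simp
  obtain h where hv: "h v = phi B v"
    and h: "\<And>w. w \<in> verts B \<Longrightarrow> edge_sum B (end_sum h) w = 2 * h w + (if w = v then 1 else 0)"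
    using phi_solution[OF B assms(6) v] by blast
  have hpos: "h v > 0" using hv assms(8) by simp
  obtain d \<xi> where "diagonalizes_adjacency (line_graph B) d \<xi>"
    using adjacency_form_diagonalization[OF fin] .
  then have \<xi>: "\<forall>j<m. linear_functional (edges B) (\<xi> j)"
    and form: "\<forall>g. adjacency_form (line_graph B) g = (\<Sum>j<m. d j * (\<xi> j g)\<^sup>2)"
    and inj: "\<forall>g. (\<forall>j<m. \<xi> j g = 0) \<longrightarrow> (\<forall>e\<in>edges B. g e = 0)"
    and ev: "\<forall>j<m. eigenvalue (adjacency_matrix (line_graph B)) (d j)"
    and \<sigma>: "\<sigma> = int (card {j. j < m \<and> d j > 0}) - int (card {j. j < m \<and> d j < 0})"
    unfolding diagonalizes_adjacency_def verts_line_graph assms(3,5) by blast+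
  define Pos where "Pos = {j. j < m \<and> d j > 0}"
  define Neg where "Neg = {j. j < m \<and> d j < 0}"
  \<comment> \<open>Nondegeneracy: an eigenvalue 0 of \<open>L(B)\<close> would make 2 an eigenvalue
    of \<open>Q(B)\<close>.\<close>
  have d0: "d j \<noteq> 0" if "j < m" for j
    using ev that eigenvalue_line_graph_0[OF B] assms(6) by metis
  have PN: "card Pos + card Neg = m"
  proof -
    have "card Pos + card Neg = card (Pos \<union> Neg)"
      by (rule card_Un_disjoint[symmetric]) (auto simp: Pos_def Neg_def)
    also have "Pos \<union> Neg = {..<m}" using d0 by (auto simp: Pos_def Neg_def neq_iff)
    finally show ?thesis by simp
  qed
  \<comment> \<open>New coordinates on \<open>L(B_k)\<close>: the bridge values \<open>y i\<close>,
    and for each copy the eigencoordinates \<open>\<psi> (i, j)\<close> of its shifted vector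
    \<open>x i f\<close>.\<close>
  define y where "y i = (\<lambda>f :: (nat \<times> 'a) set \<Rightarrow> real. f (bridge v i))" for i
  define x where "x i f = (\<lambda>e. f (Pair i ` e) + bridge_load v k f i * end_sum h e)" for i f
  define \<psi> where "\<psi> p f = \<xi> (snd p) (x (fst p) f)" for p f
  have C_form: "adjacency_form (line_graph ?C) f
      = (\<Sum>i\<in>{1..k}. \<Sum>j<m. d j * (\<psi> (i, j) f)\<^sup>2)
        - 2 * h v * (\<Sum>i\<in>{1..k}. (bridge_load v k f i)\<^sup>2) - 2 * (\<Sum>i\<in>{1..<k}. (y i f)\<^sup>2)" for f
    by (simp only: adjacency_form_chain_graph[OF B v h] form \<psi>_def x_def y_def fst_conv snd_conv)
  have load0: "bridge_load v k f i = 0" if "\<And>j. j \<in> {1..<k} \<Longrightarrow> y j f = 0" "i \<in> {1..k}" for f i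
  proof -
    have "f (bridge v i) = 0" if "i < k"
      using \<open>\<And>j. j \<in> {1..<k} \<Longrightarrow> y j f = 0\<close>[of i] \<open>i \<in> {1..k}\<close> that by (simp add: y_def)
    moreover have "f (bridge v (i - 1)) = 0" if "2 \<le> i"
      using \<open>\<And>j. j \<in> {1..<k} \<Longrightarrow> y j f = 0\<close>[of "i - 1"] \<open>i \<in> {1..k}\<close> that
      by (simp add: y_def le_diff_conv2 numeral_2_eq_2)
    ultimately show ?thesis by (simp add: bridge_load_def)
  qed
  \<comment> \<open>The change of coordinates is injective: zero bridge values remove all shifts,
    and then the \<open>\<xi> j\<close> determine each copy.\<close>
  have vanish: "f e = 0"
    if f: "\<And>j. j \<in> {1..<k} \<Longrightarrow> y j f = 0" "\<And>i j. i \<in> {1..k} \<Longrightarrow> j < m \<Longrightarrow> \<psi> (i, j) f = 0"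
      and e: "e \<in> edges ?C" for f e
  proof -
    have "f (Pair i ` e) = 0" if "i \<in> {1..k}" "e \<in> edges B" for i e
    proof -
      have "x i f e = 0"
        by (rule inj[rule_format]) (use f(2)[OF that(1)] that(2) in \<open>auto simp: \<psi>_def\<close>)
      then show ?thesis using load0[OF f(1) that(1)] by (simp add: x_def)
    qed
    then show ?thesis using e f(1) unfolding edges_chain_graph y_def by auto
  qed
  \<comment> \<open>\<open>I\<close> collects the coordinates of the negative squares, including the
    bridges, and \<open>J\<close> those of the positive ones.\<close>
  define I where "I = \<psi> ` ({1..k} \<times> Neg) \<union> y ` {1..<k}"
  define J where "J = \<psi> ` ({1..k} \<times> Pos)"
  have finP: "finite Pos" "finite Neg" by (simp_all add: Pos_def Neg_def)
  have bridge_lin: "linear_functional (edges ?C) (y i)" if "i \<in> {1..<k}" for i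
    unfolding y_def using that
    by (intro linear_functional_eval finite_edges[OF C]) (auto simp: edges_chain_graph)
  have load_lin: "linear_functional (edges ?C) (\<lambda>f. bridge_load v k f i)" if "i \<in> {1..k}" for i
  proof -
    have "linear_functional (edges ?C) (\<lambda>f. if i < k then f (bridge v i) else 0)"
    proof (cases "i < k")
      case True
      then show ?thesis using bridge_lin[of i] that by (simp add: y_def)
    qed (simp add: linear_functional_zero)
    moreover have "linear_functional (edges ?C) (\<lambda>f. if 2 \<le> i then f (bridge v (i - 1)) else 0)"
    proof (cases "2 \<le> i")
      case True
      then have "i - 1 \<in> {1..<k}" using that by auto
      then show ?thesis using bridge_lin[of "i - 1"] True by (simp add: y_def)
    qed (simp add: linear_functional_zero)
    ultimately show ?thesis unfolding bridge_load_def by (rule linear_functional_add)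
  qed
  \<comment> \<open>The shift depends on \<open>f\<close>, but linearly, through the bridge
    load.\<close>
  have \<psi>_lin: "linear_functional (edges ?C) (\<psi> (i, j))" if i: "i \<in> {1..k}" and j: "j < m" for i j
  proof -
    obtain a where a: "\<And>g. \<xi> j g = (\<Sum>e\<in>edges B. a e * g e)"
      using \<xi> j unfolding linear_functional_def by blast
    have \<psi>: "\<psi> (i, j) = (\<lambda>f. \<Sum>e\<in>edges B. a e * (f (Pair i ` e) + end_sum h e * bridge_load v k f i))"
      by (rule ext) (simp add: \<psi>_def a x_def mult_ac)
    show ?thesis unfolding \<psi>
      by (intro linear_functional_sum linear_functional_scale linear_functional_add load_lin i
          linear_functional_eval finite_edges[OF C]) (use i in \<open>force simp: edges_chain_graph\<close>)
  qed
  have "signature (line_graph ?C) = int (k * card Pos) - int (k * card Neg + (k - 1))"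
  proof (rule signature_eqI[of _ I J])
    show "finite (verts (line_graph ?C))" using finite_edges[OF C] by simp
    show "finite I" "finite J" using finP by (simp_all add: I_def J_def)
    show "linear_functional (verts (line_graph ?C)) \<chi>" if "\<chi> \<in> I \<union> J" for \<chi>
      using that \<psi>_lin bridge_lin by (auto simp: I_def J_def Pos_def Neg_def)
    show "card J \<le> k * card Pos"
      using card_image_le[of "{1..k} \<times> Pos" \<psi>] finP by (simp add: J_def card_cartesian_product)
    show "card I \<le> k * card Neg + (k - 1)"
      using card_Un_le[of "\<psi> ` ({1..k} \<times> Neg)" "y ` {1..<k}"] finP
        card_image_le[of "{1..k} \<times> Neg" \<psi>] card_image_le[of "{1..<k}" y]
      by (simp add: I_def card_cartesian_product)
    \<comment> \<open>Together with \<open>PN\<close> this shows that the claimed numbers of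
      positive and negative squares add up to the full dimension.\<close>
    have "card (edges ?C) = k * m + (k - 1)"
      using sum_edges_chain_graph[OF B, of "\<lambda>_. 1 :: nat" v k] assms(3) by simp
    then show "k * card Pos + (k * card Neg + (k - 1)) \<le> card (verts (line_graph ?C))"
      by (simp flip: PN add: distrib_left)
  next
    fix f assume ker: "\<And>\<chi>. \<chi> \<in> I \<Longrightarrow> \<chi> f = 0" and "\<exists>e\<in>verts (line_graph ?C). f e \<noteq> 0"
    then obtain e where e: "e \<in> edges ?C" "f e \<noteq> 0" by auto
    have y0: "y i f = 0" if "i \<in> {1..<k}" for i using ker that by (simp add: I_def)
    have \<psi>0: "\<psi> (i, j) f = 0" if "i \<in> {1..k}" "j \<in> Neg" for i j using ker that by (simp add: I_def)
    have q: "adjacency_form (line_graph ?C) f = (\<Sum>i\<in>{1..k}. \<Sum>j<m. d j * (\<psi> (i, j) f)\<^sup>2)"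
      unfolding C_form using y0 load0[OF y0] by simp
    have nn: "d j * (\<psi> (i, j) f)\<^sup>2 \<ge> 0" if "i \<in> {1..k}" "j < m" for i j
      using \<psi>0[OF that(1), of j] that(2) by (cases "d j < 0") (auto simp: Neg_def)
    \<comment> \<open>By \<open>vanish\<close>, some \<open>\<psi> (i, j) f\<close> is nonzero; as
      \<open>d j \<noteq> 0\<close>, its term is strictly positive.\<close>
    obtain i j where ij: "i \<in> {1..k}" "j < m" "\<psi> (i, j) f \<noteq> 0"
      using vanish[OF y0 _ e(1)] e(2) by blast
    have "0 < d j * (\<psi> (i, j) f)\<^sup>2"
      using nn[OF ij(1,2)] d0[OF ij(2)] ij(3) by (simp add: order_less_le)
    also have "\<dots> \<le> (\<Sum>j<m. d j * (\<psi> (i, j) f)\<^sup>2)"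
      using ij nn by (intro member_le_sum[of j]) auto
    also have "\<dots> \<le> (\<Sum>i\<in>{1..k}. \<Sum>j<m. d j * (\<psi> (i, j) f)\<^sup>2)"
      using ij nn by (intro member_le_sum[of i "{1..k}" "\<lambda>i. \<Sum>j<m. d j * (\<psi> (i, j) f)\<^sup>2"] sum_nonneg) auto
    finally show "adjacency_form (line_graph ?C) f > 0" by (simp add: q)
  next
    fix f assume ker: "\<And>\<chi>. \<chi> \<in> J \<Longrightarrow> \<chi> f = 0" and "\<exists>e\<in>verts (line_graph ?C). f e \<noteq> 0"
    then obtain e where e: "e \<in> edges ?C" "f e \<noteq> 0" by auto
    have \<psi>0: "\<psi> (i, j) f = 0" if "i \<in> {1..k}" "j \<in> Pos" for i j using ker that by (simp add: J_def)
    have nn: "- d j * (\<psi> (i, j) f)\<^sup>2 \<ge> 0" if "i \<in> {1..k}" "j < m" for i j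
      using \<psi>0[OF that(1), of j] that(2) by (cases "d j > 0") (auto simp: Pos_def mult_nonpos_nonneg)
    define S where "S = (\<Sum>i\<in>{1..k}. \<Sum>j<m. - d j * (\<psi> (i, j) f)\<^sup>2)"
    have q: "- adjacency_form (line_graph ?C) f
        = S + 2 * h v * (\<Sum>i\<in>{1..k}. (bridge_load v k f i)\<^sup>2) + 2 * (\<Sum>i\<in>{1..<k}. (y i f)\<^sup>2)"
      unfolding C_form S_def by (simp add: sum_negf)
    \<comment> \<open>The sign of \<open>phi B v\<close> enters here: the load squares only push the
      form further down.\<close>
    have load_nn: "2 * h v * (\<Sum>i\<in>{1..k}. (bridge_load v k f i)\<^sup>2) \<ge> 0"
      using hpos by (simp add: sum_nonneg)
    have S_nn: "S \<ge> 0" unfolding S_def using nn by (intro sum_nonneg) auto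
    have y_nn: "(\<Sum>i\<in>{1..<k}. (y i f)\<^sup>2) \<ge> 0" by (simp add: sum_nonneg)
    show "adjacency_form (line_graph ?C) f < 0"
    \<comment> \<open>Strictness comes from a nonzero bridge value if there is one, and otherwise
      from a nonzero \<open>\<psi> (i, j) f\<close> supplied by \<open>vanish\<close>.\<close>
    proof (cases "\<exists>i\<in>{1..<k}. y i f \<noteq> 0")
      case True
      then have "(\<Sum>i\<in>{1..<k}. (y i f)\<^sup>2) > 0" by (auto intro: sum_pos2)
      then show ?thesis using q load_nn S_nn by linarith
    next
      case False
      then have y0: "\<And>i. i \<in> {1..<k} \<Longrightarrow> y i f = 0" by blast
      obtain i j where ij: "i \<in> {1..k}" "j < m" "\<psi> (i, j) f \<noteq> 0"
        using vanish[OF y0 _ e(1)] e(2) by blast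
      have "0 < - d j * (\<psi> (i, j) f)\<^sup>2"
        using nn[OF ij(1,2)] d0[OF ij(2)] ij(3) by (simp add: order_less_le)
      also have "\<dots> \<le> (\<Sum>j<m. - d j * (\<psi> (i, j) f)\<^sup>2)"
        using ij nn by (intro member_le_sum[of j "{..<m}" "\<lambda>j. - d j * (\<psi> (i, j) f)\<^sup>2"]) auto
      also have "\<dots> \<le> S"
        unfolding S_def
        using ij nn by (intro member_le_sum[of i "{1..k}" "\<lambda>i. \<Sum>j<m. - d j * (\<psi> (i, j) f)\<^sup>2"] sum_nonneg) auto
      finally show ?thesis using q load_nn y_nn by linarith
    qed
  qed
  \<comment> \<open>Since \<open>k \<ge> 1\<close>, the natural number \<open>k - 1\<close> agrees
    with the integer difference.\<close>
  then show "signature (line_graph ?C) = int k * \<sigma> - (int k - 1)"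
    using k unfolding \<sigma> Pos_def[symmetric] Neg_def[symmetric] by (simp add: algebra_simps)
qed

thm_deps theorem5

end
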